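(* Let $\rho_0\in L^\infty(\Omega)$ with $0<\rho_{\min}=\operatorname{ess\,inf}\rho_0$, $\rho_{\max}=\operatorname{ess\,sup}\rho_0$, and $\boldsymbol u_0\in L^2(\Omega)^d$. Let $\mathcal D=(\mathcal M,\mathcal E)$ be a staggered discretization of $\Omega$ such that $\theta_{\mathcal D}\le\theta_0$ for some positive real number $\theta_0$, and let $\delta t$ be a time step. Let $(\rho,\boldsymbol u,p)$ be a corresponding discrete solution given by the implicit staggered scheme, viewed as functions of $(\boldsymbol x,t)$. Then: (i) $\rho_{\min}\le\rho(\boldsymbol x,t)\le\rho_{\max}$ for all $t\in(0,T]$ and a.e. $\boldsymbol x\in\Omega$; (ii) $\displaystyle\sum_{n=1}^N\delta t\sum_{\sigma\in\mathcal E_{\rm int},\,\sigma=K|L}|\sigma|(\rho_L^n-\rho_K^n)^2|\boldsymbol u_\sigma^n\cdot\boldsymbol n_{K,\sigma}|\le C_0$; (iii) $\|\boldsymbol u\|_{L^\infty((0,T);L^2(\Omega)^d)}+\|\boldsymbol u\|_{L^2((0,T);E_{\mathcal D}(\Omega))}\le C_1$, where $C_0$ and $C_1$ are positive real numbers depending only on $T$, $\Omega$, $d$, $\rho_0$, $\boldsymbol u_0$ and $\theta_0$.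
   Context: **Mesh.** $T>0$; $\Omega$ is an open bounded connected subset of $\mathbb R^d$, $d\in\{2,3\}$, polygonal if $d=2$, polyhedral if $d=3$. $|\cdot|$ denotes $d$- or $(d-1)$-dimensional measure. A *staggered discretization* $\mathcal D=(\mathcal M,\mathcal E)$ of $\Omega$ consists of a finite family $\mathcal M$ (primal mesh) of nonempty open convex quadrilaterals ($d=2$) or hexahedra ($d=3$, with planar faces) partitioning $\Omega$ up to boundaries ($\overline\Omega=\cup_{K\in\mathcal M}\overline K$), and of the set $\mathcal E$ of faces of the cells; each $\sigma\in\mathcal E$ is either contained in $\partial\Omega$ ($\sigma\in\mathcal E_{\rm ext}$) or is a whole common face of two distinct cells, $\overline K\cap\overline L=\overline\sigma$, written $\sigma=K|L$ ($\sigma\in\mathcal E_{\rm int}$). $\mathcal E(K)$ is the set of the $2d$ faces of $K$; $\boldsymbol n_{K,\sigma}$ is the unit normal to $\sigma$ outward $K$. Each $K$ is partitioned into $2d$ subvolumes $D_{K,\sigma}$, $\sigma\in\mathcal E(K)$, of equal measure $|K|/(2d)$ (for a rectangle or cuboid, $D_{K,\sigma}$ is the cone with basis $\sigma$ and vertex the mass center of $K$; for general cells, a partition into equal-volume sub-cells with the same connectivities). The dual cell of $\sigma$ is $D_\sigma=D_{K,\sigma}\cup D_{L,\sigma}$ if $\sigma=K|L$ and $D_\sigma=D_{K,\sigma}$ if $\sigma\in\mathcal E_{\rm ext}\cap\mathcal E(K)$. $\tilde{\mathcal E}(D_\sigma)$ is the set of faces of $D_\sigma$; $\epsilon=D_\sigma|D_{\sigma'}$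 is the dual face separating $D_\sigma$ and $D_{\sigma'}$. **Regularity.** $h_K$, $h_{D_\sigma}$ are the diameters of $K$, $D_\sigma$; $r_K$, $r_{D_\sigma}$ the diameters of the largest balls included in $K$, $D_\sigma$; $h_{\mathcal D}=\max_K h_K$. $\theta_{\mathcal D}$ is the maximum of the four numbers $\max_K h_K/r_K$; $\max\{r_{D_\sigma}/h_{D_{\sigma'}}:\partial D_\sigma\cap\partial D_{\sigma'}\ne\emptyset\}$; $\max\{|\partial D_{K,\sigma}|/|\partial K|: K\in\mathcal M,\sigma\in\mathcal E(K)\}$; $\max_\sigma h_{\mathcal D}/r_{D_\sigma}$. **Scheme.** Uniform time partition $0=t_0<\dots<t_N=T$, step $\delta t$. Unknowns: $\rho_K^n,p_K^n\in\mathbb R$ ($K\in\mathcal M$), $\boldsymbol u_\sigma^n\in\mathbb R^d$ ($\sigma\in\mathcal E$), with $\boldsymbol u_\sigma^n=0$ for $\sigma\in\mathcal E_{\rm ext}$. Initialization: $\rho_K^0=\frac1{|K|}\int_K\rho_0$, $\boldsymbol u_\sigma^0=\frac1{|D_\sigma|}\int_{D_\sigma}\boldsymbol u_0$ for $\sigma\in\mathcal E_{\rm int}$. For $1\le n\le N$, given step $n-1$, find $(\rho^n,\boldsymbol u^n,p^n)$ with $\sum_K|K|p_K^n=0$ and (a) $\frac1{\delta t}(\rho_K^n-\rho_K^{n-1})+\frac1{|K|}\sum_{\sigma\in\mathcal E(K)}F_{K,\sigma}^n=0$, $K\in\mathcal M$; (b) $\frac1{\delta t}(\rho_{D_\sigma}^n\boldsymbol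 u_\sigma^n-\rho_{D_\sigma}^{n-1}\boldsymbol u_\sigma^{n-1})+\frac1{|D_\sigma|}\sum_{\epsilon\in\tilde{\mathcal E}(D_\sigma)}F_{\sigma,\epsilon}^n\boldsymbol u_\epsilon^n-(\Delta\boldsymbol u)_\sigma^n+(\nabla p)_\sigma^n=0$, $\sigma\in\mathcal E_{\rm int}$; (c) $(\mathrm{div}\,\boldsymbol u)_K^n:=\frac1{|K|}\sum_{\sigma\in\mathcal E(K)}|\sigma|\boldsymbol u_\sigma^n\cdot\boldsymbol n_{K,\sigma}=0$, $K\in\mathcal M$. Here: $F_{K,\sigma}^n=|\sigma|\rho_\sigma^n\boldsymbol u_\sigma^n\cdot\boldsymbol n_{K,\sigma}$ for $\sigma=K|L$, with upwind density $\rho_\sigma^n=\rho_K^n$ if $\boldsymbol u_\sigma^n\cdot\boldsymbol n_{K,\sigma}\ge0$ and $\rho_\sigma^n=\rho_L^n$ otherwise, and $F^n_{K,\sigma}=0$ for $\sigma\in\mathcal E_{\rm ext}$; $|D_\sigma|\rho_{D_\sigma}^k=|D_{K,\sigma}|\rho_K^k+|D_{L,\sigma}|\rho_L^k$ for $\sigma=K|L$; $\boldsymbol u_\epsilon^n=\frac12(\boldsymbol u_\sigma^n+\boldsymbol u_{\sigma'}^n)$ for $\epsilon=D_\sigma|D_{\sigma'}$; $(\nabla p)_\sigma^n=\frac{|\sigma|}{|D_\sigma|}(p_L^n-p_K^n)\boldsymbol n_{K,\sigma}$ for $\sigma=K|L$; $-(\Delta\boldsymbol u)_\sigma^n=\frac1{|D_\sigma|}\sum_{K\in\mathcal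 M}\sum_{\sigma'\in\mathcal E(K)}\boldsymbol u_{\sigma'}^n\int_K\nabla\zeta_{\sigma'}\cdot\nabla\zeta_\sigma\,d\boldsymbol x$, where $\zeta_\sigma$ are the parametric Rannacher-Turek shape functions: $\zeta_\sigma|_K$ (zero on cells not having $\sigma$ as a face) is the composition with the inverse of the standard $Q_1$ map from the unit cube $\widehat K$ to $K$ of an element of $\mathrm{span}\{1,(x_i)_{1\le i\le d},(x_i^2-x_{i+1}^2)_{1\le i\le d-1}\}$, with $\int_\sigma\zeta_{\sigma'}|_K=\delta_\sigma^{\sigma'}|\sigma|$ for $\sigma,\sigma'\in\mathcal E(K)$. The dual fluxes $F_{\sigma,\epsilon}^n$ vanish for $\epsilon\subset\partial\Omega$, and those through dual faces inside $K$ are fixed linear combinations of $(F^n_{K,\sigma'})_{\sigma'\in\mathcal E(K)}$ such that: (H1) $F_{K,\sigma}+\sum_{\epsilon\in\tilde{\mathcal E}(D_\sigma),\epsilon\subset K}F_{\sigma,\epsilon}=\frac1{2d}\sum_{\sigma'\in\mathcal E(K)}F_{K,\sigma'}$ for all $\sigma\in\mathcal E(K)$; (H2) $F_{\sigma,\epsilon}=-F_{\sigma',\epsilon}$ for $\epsilon=D_\sigma|D_{\sigma'}$; (H3) $|F_{\sigma,\epsilon}|\le C\max_{\sigma'\in\mathcal E(K)}|F_{K,\sigma'}|$ with a universal constant $C$. **Discrete functions and norms.** For $t\in(t_{n-1},t_n]$: $\rho(\boldsymbol x,t)=\rho_K^n$, $p(\boldsymbol x,t)=p_K^n$ for $\boldsymbol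 x\in K$, and $\boldsymbol u(\boldsymbol x,t)=\boldsymbol u_\sigma^n$ for $\boldsymbol x\in D_\sigma$. $\|\boldsymbol u^n\|_{\mathcal E,\mathrm b}^2=\sum_{K\in\mathcal M}\int_K|\nabla\tilde{\boldsymbol u}^n|^2d\boldsymbol x$ with $\tilde{\boldsymbol u}^n=\sum_{\sigma\in\mathcal E}\boldsymbol u_\sigma^n\zeta_\sigma$. $E_{\mathcal D}(\Omega)$ is the space of discrete velocities (piecewise constant on the $D_\sigma$, zero for external $\sigma$) satisfying (c), with norm $\|\cdot\|_{\mathcal E,\mathrm b}$, and $\|\boldsymbol u\|_{L^2((0,T);E_{\mathcal D}(\Omega))}^2=\sum_{n=1}^N\delta t\,\|\boldsymbol u^n\|_{\mathcal E,\mathrm b}^2$. *)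

theory Defs
  imports "HOL-Probability.Probability"
begin

section \<open>Measures, essential bounds, gradients\<close>

definition vol :: "(real^'d) set \<Rightarrow> real" where
  "vol A = measure lebesgue A"

(* s-dimensional Hausdorff outer measure. The normalisation by the volume of the ball of
   diameter diam U makes it agree with s-dimensional Lebesgue measure on s-planes. *)
definition hausdorff_outer :: "nat \<Rightarrow> 'a::metric_space set \<Rightarrow> ennreal" where
  "hausdorff_outer s A =
     (SUP \<delta>\<in>{0::real<..}.
        INF U\<in>{U :: nat \<Rightarrow> 'a set. A \<subseteq> (\<Union>i. U i) \<and> (\<forall>i. bounded (U i) \<and> diameter (U i) \<le> \<delta>)}.
          \<Sum>i. ennreal (unit_ball_vol (real s) * (diameter (U i) / 2) ^ s))"

(* (d-1)-dimensional Hausdorff measure on Borel sets; the Hausdorff outer measure is countably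
   additive there (it is a metric outer measure), so measure_of does not degenerate. *)
definition surface_measure :: "(real^'d) measure" where
  "surface_measure = measure_of UNIV (sets borel) (hausdorff_outer (CARD('d) - 1))"

definition area :: "(real^'d) set \<Rightarrow> real" where
  "area A = enn2real (hausdorff_outer (CARD('d) - 1) A)"

definition essinf :: "'a measure \<Rightarrow> ('a \<Rightarrow> ereal) \<Rightarrow> ereal" where
  "essinf M f = - esssup M (\<lambda>x. - f x)"

definition grad :: "(real^'d \<Rightarrow> real) \<Rightarrow> real^'d \<Rightarrow> real^'d" where
  "grad f x = (THE D. GDERIV f x :> D)"

section \<open>Domain and primal mesh\<close>

definition polyhedral_domain :: "(real^'d) set \<Rightarrow> bool" where
  "polyhedral_domain \<Omega> \<longleftrightarrow>
     \<Omega> \<noteq> {} \<and> open \<Omega> \<and> bounded \<Omega> \<and> connected \<Omega> \<and>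
     (\<exists>P. finite P \<and> (\<forall>C\<in>P. polytope C) \<and> \<Omega> = interior (\<Union>P))"

(* The vertices of the unit cube are indexed by subsets S of the coordinates (those equal to 1). *)
definition q1_map :: "('d set \<Rightarrow> real^'d) \<Rightarrow> real^'d \<Rightarrow> real^'d" where
  "q1_map a x = (\<Sum>S\<in>UNIV. ((\<Prod>i\<in>S. x $ i) * (\<Prod>i\<in>-S. 1 - x $ i)) *\<^sub>R a S)"

(* K has the combinatorics of the cube: its extreme points are labelled by the cube vertices,
   and its facets are exactly the hulls of the images of the 2d facets of the cube. *)
definition cube_labelling :: "('d set \<Rightarrow> real^'d) \<Rightarrow> (real^'d) set \<Rightarrow> bool" where
  "cube_labelling a K \<longleftrightarrow>
     inj a \<and> closure K = convex hull (range a) \<and>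
     {x. x extreme_point_of closure K} = range a \<and>
     (\<forall>F. F facet_of closure K \<longleftrightarrow> (\<exists>i b. F = convex hull (a ` {S. (i \<in> S) = b})))"

(* The last two conjuncts say that the Q1 map is a regular parametrisation. They hold for every
   convex quadrilateral; for hexahedra they are what parametric finite elements presuppose. *)
definition q1_chart :: "('d set \<Rightarrow> real^'d) \<Rightarrow> (real^'d) set \<Rightarrow> bool" where
  "q1_chart a K \<longleftrightarrow>
     cube_labelling a K \<and>
     bij_betw (q1_map a) (cbox 0 1) (closure K) \<and>
     (\<forall>x\<in>cbox 0 1. det (matrix (frechet_derivative (q1_map a) (at x))) \<noteq> 0)"

definition mesh_cell :: "(real^'d) set \<Rightarrow> bool" where
  "mesh_cell K \<longleftrightarrow> K \<noteq> {} \<and> open K \<and> convex K \<and> (\<exists>a. q1_chart a K)"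

(* Faces are taken closed. *)
definition faces :: "(real^'d) set \<Rightarrow> (real^'d) set set" where
  "faces K = {\<sigma>. \<sigma> facet_of closure K}"

definition mesh_faces :: "(real^'d) set set \<Rightarrow> (real^'d) set set" where
  "mesh_faces M = (\<Union>K\<in>M. faces K)"

definition ext_faces :: "(real^'d) set \<Rightarrow> (real^'d) set set \<Rightarrow> (real^'d) set set" where
  "ext_faces \<Omega> M = {\<sigma>\<in>mesh_faces M. \<sigma> \<subseteq> frontier \<Omega>}"

definition int_faces :: "(real^'d) set \<Rightarrow> (real^'d) set set \<Rightarrow> (real^'d) set set" where
  "int_faces \<Omega> M = mesh_faces M - ext_faces \<Omega> M"

(* sigma = K|L *)
definition interface ::
  "(real^'d) set set \<Rightarrow> (real^'d) set \<Rightarrow> (real^'d) set \<Rightarrow> (real^'d) set \<Rightarrow> bool" where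
  "interface M \<sigma> K L \<longleftrightarrow>
     K \<in> M \<and> L \<in> M \<and> K \<noteq> L \<and> \<sigma> \<in> faces K \<and> \<sigma> \<in> faces L \<and> closure K \<inter> closure L = \<sigma>"

definition neighbour :: "(real^'d) set set \<Rightarrow> (real^'d) set \<Rightarrow> (real^'d) set \<Rightarrow> (real^'d) set" where
  "neighbour M K \<sigma> = (THE L. interface M \<sigma> K L)"

definition outer_normal :: "(real^'d) set \<Rightarrow> (real^'d) set \<Rightarrow> real^'d" where
  "outer_normal K \<sigma> =
     (THE n. norm n = 1 \<and> (\<exists>c. \<sigma> \<subseteq> {x. n \<bullet> x = c} \<and> K \<subseteq> {x. n \<bullet> x < c}))"

definition primal_mesh :: "(real^'d) set \<Rightarrow> (real^'d) set set \<Rightarrow> bool" where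
  "primal_mesh \<Omega> M \<longleftrightarrow>
     finite M \<and> (\<forall>K\<in>M. mesh_cell K) \<and> pairwise disjnt M \<and>
     closure \<Omega> = (\<Union>K\<in>M. closure K) \<and>
     (\<forall>\<sigma>\<in>mesh_faces M. \<sigma> \<subseteq> frontier \<Omega> \<or> (\<exists>K L. interface M \<sigma> K L))"

section \<open>Dual mesh\<close>

definition centroid :: "(real^'d) set \<Rightarrow> real^'d" where
  "centroid K = (1 / vol K) *\<^sub>R (LINT x:K|lebesgue. x)"

definition cuboid :: "(real^'d) set \<Rightarrow> bool" where
  "cuboid K \<longleftrightarrow>
     (\<exists>(c :: real^'d) (v :: 'd \<Rightarrow> real^'d). (\<forall>i j. i \<noteq> j \<longrightarrow> orthogonal (v i) (v j)) \<and>
            closure K = (\<lambda>x :: real^'d. c + (\<Sum>i\<in>UNIV. x $ i *\<^sub>R v i)) ` cbox 0 1)"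

(* Faces of K next to sigma. Only the face opposite to sigma is disjoint from it. *)
definition adjacent_faces :: "(real^'d) set \<Rightarrow> (real^'d) set \<Rightarrow> (real^'d) set set" where
  "adjacent_faces K \<sigma> = {\<sigma>'\<in>faces K. \<sigma>' \<noteq> \<sigma> \<and> \<sigma>' \<inter> \<sigma> \<noteq> {}}"

(* D sigma is the closed subvolume attached to the face sigma of K. Since the volumes add up to
   that of K, the subvolumes overlap only in null sets. The last-but-one conjunct transfers the
   connectivities of the cone partition of a cuboid to a general cell: D sigma meets the boundary
   of K exactly in sigma, and two subvolumes are separated by a dual face, i.e. a
   (d-1)-dimensional common boundary, iff the two faces are adjacent. *)
definition subvolumes :: "(real^'d) set \<Rightarrow> ((real^'d) set \<Rightarrow> (real^'d) set) \<Rightarrow> bool" where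
  "subvolumes K D \<longleftrightarrow>
     (\<forall>\<sigma>\<in>faces K. compact (D \<sigma>) \<and> closure (interior (D \<sigma>)) = D \<sigma> \<and>
                   vol (D \<sigma>) = vol K / (2 * real CARD('d))) \<and>
     (\<Union>\<sigma>\<in>faces K. D \<sigma>) = closure K \<and>
     (\<forall>\<sigma>\<in>faces K. \<forall>\<sigma>'\<in>faces K. \<sigma> \<noteq> \<sigma>' \<longrightarrow> interior (D \<sigma>) \<inter> interior (D \<sigma>') = {}) \<and>
     (\<forall>\<sigma>\<in>faces K. D \<sigma> \<inter> frontier K = \<sigma> \<and>
        (\<forall>\<sigma>'\<in>faces K. \<sigma>' \<noteq> \<sigma> \<longrightarrow>
           (0 < hausdorff_outer (CARD('d) - 1) (D \<sigma> \<inter> D \<sigma>') \<longleftrightarrow> \<sigma>' \<in> adjacent_faces K \<sigma>))) \<and>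
     (cuboid K \<longrightarrow> (\<forall>\<sigma>\<in>faces K. D \<sigma> = convex hull (insert (centroid K) \<sigma>)))"

(* D K sigma is the subvolume of K attached to sigma. *)
type_synonym 'd subvols = "(real^'d) set \<Rightarrow> (real^'d) set \<Rightarrow> (real^'d) set"

definition staggered :: "(real^'d) set \<Rightarrow> (real^'d) set set \<Rightarrow> 'd subvols \<Rightarrow> bool" where
  "staggered \<Omega> M D \<longleftrightarrow> primal_mesh \<Omega> M \<and> (\<forall>K\<in>M. subvolumes K (D K))"

definition face_cells :: "(real^'d) set set \<Rightarrow> (real^'d) set \<Rightarrow> (real^'d) set set" where
  "face_cells M \<sigma> = {K\<in>M. \<sigma> \<in> faces K}"

definition dual_cell :: "(real^'d) set set \<Rightarrow> 'd subvols \<Rightarrow> (real^'d) set \<Rightarrow> (real^'d) set" where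
  "dual_cell M D \<sigma> = (\<Union>K\<in>face_cells M \<sigma>. D K \<sigma>)"

section \<open>Regularity\<close>

definition inball_diameter :: "(real^'d) set \<Rightarrow> real" where
  "inball_diameter A = Sup {2 * r |r. 0 \<le> r \<and> (\<exists>x. ball x r \<subseteq> A)}"

definition mesh_size :: "(real^'d) set set \<Rightarrow> real" where
  "mesh_size M = Max (diameter ` M)"

definition mesh_theta :: "(real^'d) set set \<Rightarrow> 'd subvols \<Rightarrow> ennreal" where
  "mesh_theta M D = Sup
    ({ennreal (diameter K) / ennreal (inball_diameter K) |K. K \<in> M} \<union>
     {ennreal (inball_diameter (dual_cell M D \<sigma>)) / ennreal (diameter (dual_cell M D \<sigma>')) |\<sigma> \<sigma>'.
        \<sigma> \<in> mesh_faces M \<and> \<sigma>' \<in> mesh_faces M \<and>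
        frontier (dual_cell M D \<sigma>) \<inter> frontier (dual_cell M D \<sigma>') \<noteq> {}} \<union>
     {hausdorff_outer (CARD('d) - 1) (frontier (D K \<sigma>)) /
        hausdorff_outer (CARD('d) - 1) (frontier K) |K \<sigma>. K \<in> M \<and> \<sigma> \<in> faces K} \<union>
     {ennreal (mesh_size M) / ennreal (inball_diameter (dual_cell M D \<sigma>)) |\<sigma>. \<sigma> \<in> mesh_faces M})"

section \<open>Rannacher--Turek shape functions\<close>

(* Spanned by 1, the coordinates and all differences of squared coordinates; the differences of
   consecutive ones span the same space, for any ordering of the coordinates. *)
definition rt_space :: "(real^'d \<Rightarrow> real) set" where
  "rt_space = {\<lambda>x. c + (\<Sum>i\<in>UNIV. b i * x $ i) +
                       (\<Sum>i\<in>UNIV. \<Sum>j\<in>UNIV. g i j * ((x $ i)\<^sup>2 - (x $ j)\<^sup>2)) |c b g. True}"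

(* z K sigma is the restriction of the shape function of sigma to (the closure of) the cell K;
   the shape functions are in general discontinuous across the faces. *)
type_synonym 'd shapes = "(real^'d) set \<Rightarrow> (real^'d) set \<Rightarrow> real^'d \<Rightarrow> real"

definition rt_shape_functions :: "(real^'d) set set \<Rightarrow> 'd shapes \<Rightarrow> bool" where
  "rt_shape_functions M \<zeta> \<longleftrightarrow>
     (\<forall>K\<in>M.
        (\<forall>\<sigma>'\<in>faces K.
           (\<exists>a \<psi>. q1_chart a K \<and> \<psi> \<in> rt_space \<and>
              (\<forall>x\<in>closure K. \<zeta> K \<sigma>' x = \<psi> (inv_into (cbox 0 1) (q1_map a) x))) \<and>
           (\<forall>\<sigma>\<in>faces K. (LINT x:\<sigma>|surface_measure. \<zeta> K \<sigma>' x) = (if \<sigma> = \<sigma>' then area \<sigma> else 0))) \<and>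
        (\<forall>\<sigma>'. \<sigma>' \<notin> faces K \<longrightarrow> (\<forall>x\<in>closure K. \<zeta> K \<sigma>' x = 0)))"

section \<open>The scheme\<close>

type_synonym 'd scalars = "(real^'d) set \<Rightarrow> real"
type_synonym 'd vectors = "(real^'d) set \<Rightarrow> real^'d"

definition upwind_density ::
  "(real^'d) set set \<Rightarrow> 'd scalars \<Rightarrow> 'd vectors \<Rightarrow> (real^'d) set \<Rightarrow> (real^'d) set \<Rightarrow> real" where
  "upwind_density M \<rho> u K \<sigma> =
     (if 0 \<le> u \<sigma> \<bullet> outer_normal K \<sigma> then \<rho> K else \<rho> (neighbour M K \<sigma>))"

definition primal_flux ::
  "(real^'d) set \<Rightarrow> (real^'d) set set \<Rightarrow> 'd scalars \<Rightarrow> 'd vectors \<Rightarrow>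
   (real^'d) set \<Rightarrow> (real^'d) set \<Rightarrow> real" where
  "primal_flux \<Omega> M \<rho> u K \<sigma> =
     (if \<sigma> \<in> ext_faces \<Omega> M then 0
      else area \<sigma> * upwind_density M \<rho> u K \<sigma> * (u \<sigma> \<bullet> outer_normal K \<sigma>))"

definition discrete_div :: "'d vectors \<Rightarrow> (real^'d) set \<Rightarrow> real" where
  "discrete_div u K = (1 / vol K) * (\<Sum>\<sigma>\<in>faces K. area \<sigma> * (u \<sigma> \<bullet> outer_normal K \<sigma>))"

definition dual_density ::
  "(real^'d) set set \<Rightarrow> 'd subvols \<Rightarrow> 'd scalars \<Rightarrow> (real^'d) set \<Rightarrow> real" where
  "dual_density M D \<rho> \<sigma> =
     (1 / vol (dual_cell M D \<sigma>)) * (\<Sum>K\<in>face_cells M \<sigma>. vol (D K \<sigma>) * \<rho> K)"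

(* The dual face inside K separating the dual cells of sigma and sigma' is represented by the
   triple (K, sigma, sigma'), with sigma' adjacent to sigma in K. The dual flux through it is a
   linear combination, with coefficients A K sigma sigma', of the primal fluxes of K. Dual faces
   on the boundary of the domain carry no flux, and dual cells of internal faces have none. *)
type_synonym 'd flux_coeffs =
  "(real^'d) set \<Rightarrow> (real^'d) set \<Rightarrow> (real^'d) set \<Rightarrow> (real^'d) set \<Rightarrow> real"

definition dual_flux ::
  "'d flux_coeffs \<Rightarrow> ((real^'d) set \<Rightarrow> (real^'d) set \<Rightarrow> real) \<Rightarrow>
   (real^'d) set \<Rightarrow> (real^'d) set \<Rightarrow> (real^'d) set \<Rightarrow> real" where
  "dual_flux A F K \<sigma> \<sigma>' = (\<Sum>\<tau>\<in>faces K. A K \<sigma> \<sigma>' \<tau> * F K \<tau>)"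

definition dual_flux_conditions ::
  "(real^'d) set set \<Rightarrow> 'd flux_coeffs \<Rightarrow> real \<Rightarrow>
   ((real^'d) set \<Rightarrow> (real^'d) set \<Rightarrow> real) \<Rightarrow> bool" where
  "dual_flux_conditions M A C F \<longleftrightarrow>
     (\<forall>K\<in>M. \<forall>\<sigma>\<in>faces K.
        F K \<sigma> + (\<Sum>\<sigma>'\<in>adjacent_faces K \<sigma>. dual_flux A F K \<sigma> \<sigma>') =
          1 / (2 * real CARD('d)) * (\<Sum>\<tau>\<in>faces K. F K \<tau>) \<and>
        (\<forall>\<sigma>'\<in>adjacent_faces K \<sigma>.
           dual_flux A F K \<sigma> \<sigma>' = - dual_flux A F K \<sigma>' \<sigma> \<and>
           \<bar>dual_flux A F K \<sigma> \<sigma>'\<bar> \<le> C * Max ((\<lambda>\<tau>. \<bar>F K \<tau>\<bar>) ` faces K)))"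

definition convection ::
  "(real^'d) set set \<Rightarrow> 'd subvols \<Rightarrow> 'd flux_coeffs \<Rightarrow>
   ((real^'d) set \<Rightarrow> (real^'d) set \<Rightarrow> real) \<Rightarrow> 'd vectors \<Rightarrow> (real^'d) set \<Rightarrow> real^'d" where
  "convection M D A F u \<sigma> =
     (1 / vol (dual_cell M D \<sigma>)) *\<^sub>R
       (\<Sum>K\<in>face_cells M \<sigma>. \<Sum>\<sigma>'\<in>adjacent_faces K \<sigma>.
          dual_flux A F K \<sigma> \<sigma>' *\<^sub>R ((1/2) *\<^sub>R (u \<sigma> + u \<sigma>')))"

definition neg_laplacian ::
  "(real^'d) set set \<Rightarrow> 'd subvols \<Rightarrow> 'd shapes \<Rightarrow> 'd vectors \<Rightarrow> (real^'d) set \<Rightarrow> real^'d" where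
  "neg_laplacian M D \<zeta> u \<sigma> =
     (1 / vol (dual_cell M D \<sigma>)) *\<^sub>R
       (\<Sum>K\<in>M. \<Sum>\<sigma>'\<in>faces K. (LINT x:K|lebesgue. grad (\<zeta> K \<sigma>') x \<bullet> grad (\<zeta> K \<sigma>) x) *\<^sub>R u \<sigma>')"

(* For sigma = K|L; the value does not change when K and L are exchanged. *)
definition pressure_gradient ::
  "(real^'d) set set \<Rightarrow> 'd subvols \<Rightarrow> 'd scalars \<Rightarrow>
   (real^'d) set \<Rightarrow> (real^'d) set \<Rightarrow> (real^'d) set \<Rightarrow> real^'d" where
  "pressure_gradient M D p \<sigma> K L =
     (area \<sigma> / vol (dual_cell M D \<sigma>) * (p L - p K)) *\<^sub>R outer_normal K \<sigma>"

definition scheme_step ::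
  "(real^'d) set \<Rightarrow> (real^'d) set set \<Rightarrow> 'd subvols \<Rightarrow> 'd shapes \<Rightarrow> 'd flux_coeffs \<Rightarrow> real \<Rightarrow>
   'd scalars \<Rightarrow> 'd vectors \<Rightarrow> 'd scalars \<Rightarrow> 'd vectors \<Rightarrow> 'd scalars \<Rightarrow> bool" where
  "scheme_step \<Omega> M D \<zeta> A dt \<rho>' u' \<rho> u p \<longleftrightarrow>
     (\<Sum>K\<in>M. vol K * p K) = 0 \<and>
     (\<forall>K\<in>M. (1 / dt) * (\<rho> K - \<rho>' K) +
             (1 / vol K) * (\<Sum>\<sigma>\<in>faces K. primal_flux \<Omega> M \<rho> u K \<sigma>) = 0) \<and>
     (\<forall>\<sigma>\<in>int_faces \<Omega> M. \<forall>K L. interface M \<sigma> K L \<longrightarrow>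
        (1 / dt) *\<^sub>R (dual_density M D \<rho> \<sigma> *\<^sub>R u \<sigma> - dual_density M D \<rho>' \<sigma> *\<^sub>R u' \<sigma>) +
        convection M D A (primal_flux \<Omega> M \<rho> u) u \<sigma> +
        neg_laplacian M D \<zeta> u \<sigma> +
        pressure_gradient M D p \<sigma> K L = 0) \<and>
     (\<forall>K\<in>M. discrete_div u K = 0)"

definition discrete_solution ::
  "(real^'d) set \<Rightarrow> (real^'d \<Rightarrow> real) \<Rightarrow> (real^'d \<Rightarrow> real^'d) \<Rightarrow>
   (real^'d) set set \<Rightarrow> 'd subvols \<Rightarrow> 'd shapes \<Rightarrow> 'd flux_coeffs \<Rightarrow> real \<Rightarrow> nat \<Rightarrow> real \<Rightarrow>
   (nat \<Rightarrow> 'd scalars) \<Rightarrow> (nat \<Rightarrow> 'd vectors) \<Rightarrow> (nat \<Rightarrow> 'd scalars) \<Rightarrow> bool" where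
  "discrete_solution \<Omega> \<rho>0 u0 M D \<zeta> A C N dt \<rho> u p \<longleftrightarrow>
     (\<forall>K\<in>M. \<rho> 0 K = (1 / vol K) * (LINT x:K|lebesgue. \<rho>0 x)) \<and>
     (\<forall>\<sigma>\<in>int_faces \<Omega> M.
        u 0 \<sigma> = (1 / vol (dual_cell M D \<sigma>)) *\<^sub>R (LINT x:dual_cell M D \<sigma>|lebesgue. u0 x)) \<and>
     (\<forall>n\<in>{0..N}. \<forall>\<sigma>\<in>ext_faces \<Omega> M. u n \<sigma> = 0) \<and>
     (\<forall>n\<in>{1..N}. scheme_step \<Omega> M D \<zeta> A dt (\<rho> (n - 1)) (u (n - 1)) (\<rho> n) (u n) (p n) \<and>
                  dual_flux_conditions M A C (primal_flux \<Omega> M (\<rho> n) (u n)))"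

section \<open>Discrete functions and norms\<close>

(* The index n with t in (t_{n-1}, t_n]. *)
definition time_index :: "real \<Rightarrow> real \<Rightarrow> nat" where
  "time_index dt t = nat \<lceil>t / dt\<rceil>"

definition density_fun :: "(real^'d) set set \<Rightarrow> real \<Rightarrow> (nat \<Rightarrow> 'd scalars) \<Rightarrow> real^'d \<Rightarrow> real \<Rightarrow> real" where
  "density_fun M dt \<rho> x t = (\<Sum>K\<in>M. indicator K x * \<rho> (time_index dt t) K)"

(* Interiors make the dual cells disjoint; this matters only on a null set. *)
definition velocity_fun ::
  "(real^'d) set set \<Rightarrow> 'd subvols \<Rightarrow> real \<Rightarrow> (nat \<Rightarrow> 'd vectors) \<Rightarrow> real^'d \<Rightarrow> real \<Rightarrow> real^'d" where
  "velocity_fun M D dt u x t =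
     (\<Sum>\<sigma>\<in>mesh_faces M. indicator (interior (dual_cell M D \<sigma>)) x *\<^sub>R u (time_index dt t) \<sigma>)"

definition L2_norm_on :: "(real^'d) set \<Rightarrow> (real^'d \<Rightarrow> real^'d) \<Rightarrow> real" where
  "L2_norm_on \<Omega> f = sqrt (LINT x:\<Omega>|lebesgue. (norm (f x))\<^sup>2)"

definition Linf_L2_norm :: "(real^'d) set \<Rightarrow> real \<Rightarrow> (real^'d \<Rightarrow> real \<Rightarrow> real^'d) \<Rightarrow> ereal" where
  "Linf_L2_norm \<Omega> T f =
     esssup (lebesgue_on {0<..<T}) (\<lambda>t. ereal (L2_norm_on \<Omega> (\<lambda>x. f x t)))"

definition broken_norm :: "(real^'d) set set \<Rightarrow> 'd shapes \<Rightarrow> 'd vectors \<Rightarrow> real" where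
  "broken_norm M \<zeta> u = sqrt (\<Sum>K\<in>M. LINT x:K|lebesgue.
     (\<Sum>j\<in>UNIV. (norm (grad (\<lambda>y. (\<Sum>\<sigma>\<in>mesh_faces M. \<zeta> K \<sigma> y *\<^sub>R u \<sigma>) $ j) x))\<^sup>2))"

definition L2_broken_norm ::
  "(real^'d) set set \<Rightarrow> 'd shapes \<Rightarrow> nat \<Rightarrow> real \<Rightarrow> (nat \<Rightarrow> 'd vectors) \<Rightarrow> real" where
  "L2_broken_norm M \<zeta> N dt u = sqrt (\<Sum>n\<in>{1..N}. dt * (broken_norm M \<zeta> (u n))\<^sup>2)"

(* SOME picks one of the two orderings (K, L) of the cells sharing sigma; the summand is
   symmetric in K and L. *)
definition weak_BV ::
  "(real^'d) set \<Rightarrow> (real^'d) set set \<Rightarrow> nat \<Rightarrow> real \<Rightarrow> (nat \<Rightarrow> 'd scalars) \<Rightarrow> (nat \<Rightarrow> 'd vectors) \<Rightarrow> real" where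
  "weak_BV \<Omega> M N dt \<rho> u =
     (\<Sum>n\<in>{1..N}. dt * (\<Sum>\<sigma>\<in>int_faces \<Omega> M.
        (let (K, L) = (SOME (K, L). interface M \<sigma> K L)
         in area \<sigma> * (\<rho> n L - \<rho> n K)\<^sup>2 * \<bar>u n \<sigma> \<bullet> outer_normal K \<sigma>\<bar>)))"

end

(* Discrete maximum principle: since the discrete velocity is divergence free, the upwind mass
   balance expresses the new density in a cell as a convex combination of its old value and of
   new neighbouring values. Testing the mass balance with the density gives the weak BV estimate:
   the upwind choice contributes |u.n| (rho_L - rho_K)^2 on every internal face.
   For the velocity, test the momentum balance of each dual cell with u_sigma. By (H1), the dual
   cells satisfy a discrete mass balance too, so that convection only exchanges kinetic energy
   through the antisymmetric dual fluxes; the pressure term vanishes by incompressibility and the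
   diffusion term is the square of the broken norm. The initial kinetic energy is controlled by
   the L2 norm of u0 through Jensen's inequality on the dual cells. *)
theory Submission
  imports Defs
begin

section \<open>Faces and normals of the cells\<close>

text \<open>The scheme is written with definite descriptions and choice
  (\<open>outer_normal\<close>, \<open>neighbour\<close>, the pair in \<open>weak_BV\<close>) and
  with Bochner integrals, which default to 0. Each has to receive its intended meaning before the
  energy argument becomes algebra. For the descriptions, planarity of the facets is the key: a facet
  determines its unit normal up to sign, and two cells on the same side of a common facet overlap
  near it. Hence a facet has at most two cells, with opposite normals, and the fluxes are
  conservative. For the integrals, the shape gradients extend continuously to the compact closure of
  a cell, so that the broken norm really expands into the stiffness matrix. The velocity constants
  come from a single energy, summed over the subvolumes of each cell. Averages of the initial
  velocity and point values of the discrete velocity are compared with cell quantities by counting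
  faces, at the cost of powers of 2d; thus only d, \<Omega> and the data enter.\<close>

lemma hyperplane_unique:
  fixes n m :: "'a::euclidean_space"
  assumes "aff_dim S = int DIM('a) - 1" "norm n = 1" "norm m = 1"
    "S \<subseteq> {x. n \<bullet> x = c}" "S \<subseteq> {x. m \<bullet> x = e}" "S \<noteq> {}"
  shows "(m = n \<and> e = c) \<or> (m = - n \<and> e = - c)"
proof -
  obtain a b where a: "a \<noteq> 0" and ab: "affine hull S = {x. a \<bullet> x = b}"
    using assms(1) aff_dim_eq_hyperplane[of S] by (auto simp: of_nat_diff Suc_leI)
  obtain x0 where x0: "x0 \<in> S" using assms by auto
  \<comment> \<open>A functional constant on \<open>S\<close> is constant on its affine hull. Moving
    \<open>x0\<close> by \<open>y\<close>, the component of \<open>k\<close> orthogonal to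
    \<open>a\<close>, stays in that hyperplane, so \<open>y\<close> must vanish.\<close>
  have par: "k = (k \<bullet> a / (a \<bullet> a)) *\<^sub>R a" if "S \<subseteq> {x. k \<bullet> x = r}" for k r
  proof -
    have sub: "{x. a \<bullet> x = b} \<subseteq> {x. k \<bullet> x = r}"
      using hull_minimal[of S _ affine, OF that affine_hyperplane] ab by simp
    define y where "y = k - (k \<bullet> a / (a \<bullet> a)) *\<^sub>R a"
    have ay: "a \<bullet> y = 0" using a by (simp add: y_def inner_diff_right inner_commute)
    have ax0: "a \<bullet> x0 = b" using x0 ab hull_inc[of x0 S affine] by auto
    then have "a \<bullet> (x0 + y) = b" using ay by (simp add: inner_add_right)
    then have "k \<bullet> (x0 + y) = r" "k \<bullet> x0 = r" using sub ax0 by blast+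
    then have "k \<bullet> y = 0" by (simp add: inner_add_right)
    then have "y \<bullet> y = 0" using ay by (simp add: y_def inner_diff_left inner_diff_right inner_commute)
    then show ?thesis by (simp add: y_def)
  qed
  obtain s where s: "n = s *\<^sub>R a" using par[OF assms(4)] by blast
  obtain t where t: "m = t *\<^sub>R a" using par[OF assms(5)] by blast
  have "\<bar>s\<bar> * norm a = 1" "\<bar>t\<bar> * norm a = 1" using assms(2,3) s t by auto
  then have "\<bar>s\<bar> = \<bar>t\<bar>" using a by (metis mult_right_cancel norm_eq_zero)
  then have "m = n \<or> m = - n" using s t by (auto simp: abs_eq_iff)
  moreover have "n \<bullet> x0 = c" "m \<bullet> x0 = e" using assms x0 by auto
  ultimately show ?thesis by auto
qed

(* Near a relative interior point of S, both sets contain the points strictly on the given side of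
   the hyperplane spanned by S. *)
lemma same_side_meet:
  fixes n :: "'a::euclidean_space"
  assumes S: "aff_dim S = int DIM('a) - 1" "convex S" "S \<noteq> {}" "S \<subseteq> {x. n \<bullet> x = c}" and n: "norm n = 1"
    and K: "open K" "convex K" "K \<noteq> {}" "S \<subseteq> closure K" "K \<subseteq> {x. n \<bullet> x < c}"
    and L: "open L" "convex L" "L \<noteq> {}" "S \<subseteq> closure L" "L \<subseteq> {x. n \<bullet> x < c}"
  shows "K \<inter> L \<noteq> {}"
proof -
  obtain x where x: "x \<in> rel_interior S" using S rel_interior_eq_empty by blast
  then have xS: "x \<in> S" using rel_interior_subset by blast
  have nx: "n \<bullet> x = c" using xS S by auto
  have aff: "affine hull S = {x. n \<bullet> x = c}"
  proof -
    obtain a b where a: "a \<noteq> 0" and ab: "affine hull S = {x. a \<bullet> x = b}"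
      using S(1) aff_dim_eq_hyperplane[of S] by (auto simp: of_nat_diff Suc_leI)
    have an: "norm (a /\<^sub>R norm a) = 1" using a by simp
    have "S \<subseteq> {x. (a /\<^sub>R norm a) \<bullet> x = b / norm a}" using ab hull_subset[of S affine] by (auto simp: field_simps)
    from hyperplane_unique[OF S(1) n an S(4) this S(3)] 
    have "(a /\<^sub>R norm a = n \<and> b / norm a = c) \<or> (a /\<^sub>R norm a = - n \<and> b / norm a = - c)" .
    moreover have "a = norm a *\<^sub>R (a /\<^sub>R norm a)" "b = norm a * (b / norm a)" using a by auto
    ultimately have "(a = norm a *\<^sub>R n \<and> b = norm a * c) \<or> (a = (- norm a) *\<^sub>R n \<and> b = - norm a * c)"
      by (metis mult_minus_left mult_minus_right scaleR_minus_left scaleR_minus_right)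
    then obtain r where "r \<noteq> 0" "a = r *\<^sub>R n" "b = r * c" 
      using a by (metis mult_minus_left neg_equal_0_iff_equal norm_eq_zero)
    then show ?thesis using ab by auto
  qed
  obtain e where e: "e > 0" "ball x e \<inter> affine hull S \<subseteq> S"
    using x by (auto simp: mem_rel_interior_ball)
  obtain y1 where y1: "y1 \<in> K" using K by auto
  obtain y2 where y2: "y2 \<in> L" using L by auto
  \<comment> \<open>\<alpha> is the ratio of the depths of \<open>y1\<close> and \<open>y2\<close>
    below the hyperplane. It makes \<open>w\<close> tangential, so a short step from
    \<open>x\<close> towards \<open>y1\<close> can also be reached from a shifted point of
    \<open>S\<close> by a step towards \<open>y2\<close>.\<close>
  define \<alpha> where "\<alpha> = (c - n \<bullet> y1) / (c - n \<bullet> y2)"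
  have pos: "c - n \<bullet> y1 > 0" "c - n \<bullet> y2 > 0" using y1 y2 K L by auto
  then have \<alpha>: "\<alpha> > 0" by (simp add: \<alpha>_def)
  define w where "w = y1 - x - \<alpha> *\<^sub>R (y2 - x)"
  have nw: "n \<bullet> w = 0" 
  proof -
    have "n \<bullet> w = (n \<bullet> y1 - c) - \<alpha> * (n \<bullet> y2 - c)" using nx by (simp add: w_def inner_diff_right)
    also have "\<dots> = 0" using pos by (simp add: \<alpha>_def field_simps)
    finally show ?thesis .
  qed
  \<comment> \<open>The three bounds keep the step towards \<open>y1\<close> inside
    \<open>K\<close>, keep the step \<open>t * \<alpha>\<close> towards \<open>y2\<close> at most
    1/2, and keep the shifted base point within distance \<open>e\<close> of \<open>x\<close>.
    Adding 1 to the norm of \<open>w\<close> covers w = 0.\<close>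
  define t where "t = min (1/2) (min (1 / (2 * \<alpha>)) (e / (4 * (norm w + 1))))"
  have t: "t > 0" "t \<le> 1/2" "t * \<alpha> \<le> 1/2" "t * norm w < e / 2"
  proof -
    have "norm w + 1 > 0" by (simp add: add_nonneg_pos)
    then show "t > 0" using \<alpha> e unfolding t_def by simp
    show "t \<le> 1/2" unfolding t_def by (rule min.cobounded1)
    have "t \<le> 1 / (2*\<alpha>)" by (simp add: t_def)
    then show "t * \<alpha> \<le> 1/2" using \<alpha> by (simp add: field_simps)
    have w1: "norm w + 1 > 0" by (simp add: add_nonneg_pos)
    have "t \<le> e / (4 * (norm w + 1))" by (simp add: t_def)
    then have "t * (4 * (norm w + 1)) \<le> e" using w1 by (simp add: pos_le_divide_eq)
    moreover have "t * norm w < t * (norm w + 1)" using \<open>t > 0\<close> by simp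
    moreover have "t * (norm w + 1) \<le> e / 4" using calculation by (simp add: algebra_simps)
    ultimately show "t * norm w < e / 2" using e by linarith
  qed
  define z where "z = x - t *\<^sub>R (x - y1)"
  have "z \<in> K"
  proof -
    have "x - t *\<^sub>R (x - y1) \<in> interior K"
      by (rule mem_interior_closure_convex_shrink) (use K y1 xS t in \<open>auto simp: interior_open\<close>)
    then show ?thesis using K by (simp add: z_def interior_open)
  qed
  moreover have "z \<in> L"
  proof -
    define s where "s = t * \<alpha>"
    have s: "0 < s" "s \<le> 1/2" using t \<alpha> by (auto simp: s_def)
    \<comment> \<open>The solution of (1 - s) x' + s y2 = z. Its offset from \<open>x\<close> is a
      multiple of the tangential \<open>w\<close>, hence \<open>x'\<close> stays in
      \<open>S\<close>.\<close>
    define x' where "x' = x + (t / (1 - s)) *\<^sub>R w"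
    have "n \<bullet> x' = c" using nx nw by (simp add: x'_def inner_add_right)
    moreover have "dist x x' < e"
    proof -
      have "dist x x' = t / (1 - s) * norm w" using t s by (simp add: x'_def dist_norm)
      also have "\<dots> \<le> 2 * t * norm w"
        by (rule mult_right_mono) (use t s in \<open>auto simp: field_simps\<close>)
      also have "\<dots> < e" using t by simp
      finally show ?thesis .
    qed
    ultimately have "x' \<in> S" using e aff by auto
    then have "x' - s *\<^sub>R (x' - y2) \<in> interior L"
      by (intro mem_interior_closure_convex_shrink) (use L y2 s in \<open>auto simp: interior_open\<close>)
    moreover have "x' - s *\<^sub>R (x' - y2) = z"
    proof -
      have "x' - s *\<^sub>R (x' - y2) = (1 - s) *\<^sub>R x' + s *\<^sub>R y2" by (simp add: algebra_simps)
      also have "(1 - s) *\<^sub>R x' = (1 - s) *\<^sub>R x + t *\<^sub>R w" using s by (simp add: x'_def scaleR_add_right)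
      also have "(1 - s) *\<^sub>R x + t *\<^sub>R w + s *\<^sub>R y2 = z"
        by (simp add: w_def s_def z_def algebra_simps)
      finally show ?thesis .
    qed
    ultimately show ?thesis using L by (simp add: interior_open)
  qed
  ultimately show ?thesis by blast
qed

section \<open>Cells as polytopes, their facets and outer normals\<close>

lemma mesh_cell_polytope:
  assumes "mesh_cell K" shows "polytope (closure K)"
  using assms unfolding mesh_cell_def q1_chart_def cube_labelling_def polytope_def
  by (metis finite_class.finite_UNIV finite_imageI)

lemma mesh_cellD:
  assumes "mesh_cell K"
  shows "open K" "convex K" "K \<noteq> {}" "bounded K" "compact (closure K)" "interior (closure K) = K"
    "K \<in> lmeasurable" "0 < vol K" "negligible (closure K - K)"
proof -
  show 1: "open K" "convex K" "K \<noteq> {}" using assms by (auto simp: mesh_cell_def)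
  show 2: "compact (closure K)" using mesh_cell_polytope[OF assms] polytope_imp_compact by blast
  then show 3: "bounded K" by (rule bounded_subset[OF compact_imp_bounded closure_subset])
  show "interior (closure K) = K" using 1 by (simp add: convex_interior_closure interior_open)
  show 4: "K \<in> lmeasurable" using 1 3 by (simp add: lmeasurable_open)
  have "\<not> negligible K" using 1 open_not_negligible by blast
  then show "0 < vol K" unfolding vol_def
    using 4 by (metis measure_nonneg negligible_iff_measure order_le_imp_less_or_eq)
  have "closure K - K = frontier K" using 1 by (simp add: frontier_def interior_open)
  then show "negligible (closure K - K)" using negligible_convex_frontier 1 by metis
qed

lemma mesh_cell_finite_faces: "mesh_cell K \<Longrightarrow> finite (faces K)"
  by (simp add: faces_def finite_polytope_facets mesh_cell_polytope)

text \<open>A facet of the cube is a coordinate with one of two sides. The count controls how often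
  a cell is repeated when the energy estimates sum over faces.\<close>

lemma card_faces_le:
  fixes K :: "(real^'d) set"
  assumes "mesh_cell K" shows "card (faces K) \<le> 2 * CARD('d)"
proof -
  obtain a :: "'d set \<Rightarrow> real^'d" where "cube_labelling a K"
    using assms by (auto simp: mesh_cell_def q1_chart_def)
  then have "faces K = (\<lambda>(i, b). convex hull (a ` {S. (i \<in> S) = b})) ` UNIV"
    unfolding cube_labelling_def faces_def by (auto simp: image_iff; blast)
  then have "card (faces K) \<le> card (UNIV :: ('d \<times> bool) set)"
    using card_image_le[OF finite_class.finite_UNIV] by metis
  then show ?thesis by (simp add: card_UNIV_bool card_cartesian_product flip: UNIV_Times_UNIV)
qed

lemma faceD:
  fixes K :: "(real^'d) set"
  assumes "mesh_cell K" "\<sigma> \<in> faces K"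
  shows "aff_dim \<sigma> = int DIM(real^'d) - 1" "convex \<sigma>" "\<sigma> \<noteq> {}" "\<sigma> \<subseteq> closure K"
proof -
  have f: "\<sigma> facet_of closure K" using assms by (simp add: faces_def)
  have "aff_dim (closure K) = int DIM(real^'d)"
    using mesh_cellD[OF assms(1)] by (metis aff_dim_open closure_aff_dim)
  then show "aff_dim \<sigma> = int DIM(real^'d) - 1" using f by (simp add: facet_of_def)
  show "convex \<sigma>" using f facet_of_imp_face_of face_of_imp_convex by blast
  show "\<sigma> \<noteq> {}" using f by (auto simp: facet_of_def)
  show "\<sigma> \<subseteq> closure K" using f facet_of_imp_subset by blast
qed

text \<open>This resolves the definite description in \<open>outer_normal\<close>. The inequality
  that cuts the facet out of the polytope, normalised, gives existence, and it is strict on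
  \<open>K\<close> because an open set lies in the interior of the half-space. Uniqueness up to sign
  is \<open>hyperplane_unique\<close>; any point of \<open>K\<close> fixes the sign.\<close>

lemma outer_normal_spec:
  fixes K :: "(real^'d) set"
  assumes K: "mesh_cell K" and \<sigma>: "\<sigma> \<in> faces K"
  obtains c where "norm (outer_normal K \<sigma>) = 1" "\<sigma> \<subseteq> {x. outer_normal K \<sigma> \<bullet> x = c}"
    "K \<subseteq> {x. outer_normal K \<sigma> \<bullet> x < c}"
proof -
  let ?P = "\<lambda>n. norm n = 1 \<and> (\<exists>c. \<sigma> \<subseteq> {x. n \<bullet> x = c} \<and> K \<subseteq> {x. n \<bullet> x < c})"
  obtain a b where a: "a \<noteq> 0" "closure K \<subseteq> {x. a \<bullet> x \<le> b}" "\<sigma> = closure K \<inter> {x. a \<bullet> x = b}"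
    using facet_of_polyhedron[OF polytope_imp_polyhedron[OF mesh_cell_polytope[OF K]], of \<sigma>] \<sigma>
    by (auto simp: faces_def)
  have "K \<subseteq> interior {x. a \<bullet> x \<le> b}"
    using a mesh_cellD[OF K] closure_subset by (metis interior_maximal subset_trans)
  then have Klt: "K \<subseteq> {x. a \<bullet> x < b}" using a by (simp add: interior_halfspace_le)
  have "?P (a /\<^sub>R norm a)"
    using a Klt by (auto intro!: exI[of _ "b / norm a"] simp: field_simps)
  then obtain n where n: "?P n" by blast
  moreover have "m = n" if m: "?P m" for m
  proof -
    obtain c where c: "\<sigma> \<subseteq> {x. n \<bullet> x = c}" "K \<subseteq> {x. n \<bullet> x < c}"
      using conjunct2[OF n] by (elim exE conjE)
    obtain e where e: "\<sigma> \<subseteq> {x. m \<bullet> x = e}" "K \<subseteq> {x. m \<bullet> x < e}"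
      using conjunct2[OF m] by (elim exE conjE)
    have "(m = n \<and> e = c) \<or> (m = - n \<and> e = - c)"
      using hyperplane_unique[OF faceD(1)[OF K \<sigma>] conjunct1[OF n] conjunct1[OF m] c(1) e(1) faceD(3)[OF K \<sigma>]] .
    moreover have "\<not> (m = - n \<and> e = - c)"
    proof
      assume *: "m = - n \<and> e = - c"
      obtain x where "x \<in> K" using mesh_cellD(3)[OF K] by blast
      then have "n \<bullet> x < c" "m \<bullet> x < e" using c(2) e(2) by blast+
      then show False using * by simp
    qed
    ultimately show ?thesis by blast
  qed
  ultimately have P: "?P (outer_normal K \<sigma>)" unfolding outer_normal_def by (rule theI)
  show ?thesis using conjunct2[OF P] that[OF conjunct1[OF P]] by (elim exE conjE)
qed

text \<open>Equal normals would put both cells on the same side of their common facet, where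
  \<open>same_side_meet\<close> makes them intersect.\<close>

lemma outer_normal_opposite:
  assumes K: "mesh_cell K" "\<sigma> \<in> faces K" and L: "mesh_cell L" "\<sigma> \<in> faces L" and "disjnt K L"
  shows "outer_normal L \<sigma> = - outer_normal K \<sigma>"
proof -
  obtain c where c: "norm (outer_normal K \<sigma>) = 1" "\<sigma> \<subseteq> {x. outer_normal K \<sigma> \<bullet> x = c}"
    "K \<subseteq> {x. outer_normal K \<sigma> \<bullet> x < c}" by (rule outer_normal_spec[OF K])
  obtain e where e: "norm (outer_normal L \<sigma>) = 1" "\<sigma> \<subseteq> {x. outer_normal L \<sigma> \<bullet> x = e}"
    "L \<subseteq> {x. outer_normal L \<sigma> \<bullet> x < e}" by (rule outer_normal_spec[OF L])
  have "\<not> (outer_normal L \<sigma> = outer_normal K \<sigma> \<and> e = c)"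
  proof
    assume *: "outer_normal L \<sigma> = outer_normal K \<sigma> \<and> e = c"
    have "K \<inter> L \<noteq> {}"
      by (rule same_side_meet[OF faceD(1-3)[OF K] c(2,1) mesh_cellD(1-3)[OF K(1)] faceD(4)[OF K] c(3)
            mesh_cellD(1-3)[OF L(1)] faceD(4)[OF L]]) (use e * in auto)
    with assms show False by (simp add: disjnt_def)
  qed
  with hyperplane_unique[OF faceD(1)[OF K] c(1) e(1) c(2) e(2) faceD(3)[OF K]] show ?thesis by blast
qed

text \<open>Three pairwise disjoint cells would have pairwise opposite normals on the common face,
  and a vector equal to its own negative is not a unit vector.\<close>

lemma at_most_two_cells:
  assumes "mesh_cell K1" "mesh_cell K2" "mesh_cell K3" "\<sigma> \<in> faces K1" "\<sigma> \<in> faces K2" "\<sigma> \<in> faces K3"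
    "disjnt K1 K2" "disjnt K1 K3"
  shows "\<not> disjnt K2 K3"
proof
  assume "disjnt K2 K3"
  have "outer_normal K2 \<sigma> = - outer_normal K1 \<sigma>"
    by (rule outer_normal_opposite) (use assms in auto)
  moreover have "outer_normal K3 \<sigma> = - outer_normal K1 \<sigma>"
    by (rule outer_normal_opposite) (use assms in auto)
  moreover have "outer_normal K3 \<sigma> = - outer_normal K2 \<sigma>"
    by (rule outer_normal_opposite) (use assms \<open>disjnt K2 K3\<close> in auto)
  ultimately have "outer_normal K1 \<sigma> = 0" by (simp add: eq_neg_iff_add_eq_0 flip: scaleR_2)
  moreover have "norm (outer_normal K1 \<sigma>) = 1" using outer_normal_spec[of K1 \<sigma>] assms by blast
  ultimately show False by simp
qed

section \<open>Gradients of the shape functions\<close>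

text \<open>Continuity of every directional derivative amounts, on a finite-dimensional domain, to
  continuity of the derivative as an operator-valued map. In this form the closure rules reduce to
  continuity of scalar or vector expressions.\<close>

definition cont_diff :: "('a::real_normed_vector \<Rightarrow> 'b::real_normed_vector) \<Rightarrow> bool" where
  "cont_diff f \<longleftrightarrow> (\<exists>f'. (\<forall>x. (f has_derivative f' x) (at x)) \<and> (\<forall>v. continuous_on UNIV (\<lambda>x. f' x v)))"

lemma cont_diff_bounded_linear: "bounded_linear f \<Longrightarrow> cont_diff f"
  unfolding cont_diff_def by (intro exI[of _ "\<lambda>x. f"]) (auto intro: bounded_linear_imp_has_derivative)

lemma cont_diff_const: "cont_diff (\<lambda>x. c)"
  unfolding cont_diff_def by (intro exI[of _ "\<lambda>x v. 0"]) auto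

lemma cont_diff_nth: "cont_diff (\<lambda>x :: real^'n. x $ i)"
  by (intro cont_diff_bounded_linear bounded_linear_vec_nth)

lemma cont_diff_add:
  assumes "cont_diff f" "cont_diff g" shows "cont_diff (\<lambda>x. f x + g x)"
proof -
  obtain f' g' where "\<And>x. (f has_derivative f' x) (at x)" "\<And>v. continuous_on UNIV (\<lambda>x. f' x v)"
    "\<And>x. (g has_derivative g' x) (at x)" "\<And>v. continuous_on UNIV (\<lambda>x. g' x v)"
    using assms by (auto simp: cont_diff_def)
  then show ?thesis unfolding cont_diff_def
    by (intro exI[of _ "\<lambda>x v. f' x v + g' x v"]) (auto intro!: has_derivative_add continuous_on_add)
qed

lemma cont_diff_scaleR:
  assumes "cont_diff f" "cont_diff g" shows "cont_diff (\<lambda>x. f x *\<^sub>R g x)"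
proof -
  obtain f' g' where *: "\<And>x. (f has_derivative f' x) (at x)" "\<And>v. continuous_on UNIV (\<lambda>x. f' x v)"
    "\<And>x. (g has_derivative g' x) (at x)" "\<And>v. continuous_on UNIV (\<lambda>x. g' x v)"
    using assms by (auto simp: cont_diff_def)
  then have "continuous_on UNIV f" "continuous_on UNIV g"
    by (meson has_derivative_continuous continuous_at_imp_continuous_on)+
  with * show ?thesis unfolding cont_diff_def
    by (intro exI[of _ "\<lambda>x v. f x *\<^sub>R g' x v + f' x v *\<^sub>R g x"])
       (auto intro!: has_derivative_scaleR continuous_intros)
qed

lemma cont_diff_mult: "cont_diff f \<Longrightarrow> cont_diff g \<Longrightarrow> cont_diff (\<lambda>x. f x * g x :: real)"
  using cont_diff_scaleR[of f g] by simp

lemma cont_diff_diff: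
  assumes "cont_diff f" "cont_diff g" shows "cont_diff (\<lambda>x. f x - g x)"
  using cont_diff_add[OF assms(1) cont_diff_scaleR[OF cont_diff_const[of "-1"] assms(2)]] by simp

lemma cont_diff_sum: "(\<And>i. i \<in> I \<Longrightarrow> cont_diff (f i)) \<Longrightarrow> cont_diff (\<lambda>x. \<Sum>i\<in>I. f i x)"
  by (induction I rule: infinite_finite_induct) (auto intro: cont_diff_const cont_diff_add)

lemma cont_diff_prod: "(\<And>i. i \<in> I \<Longrightarrow> cont_diff (f i)) \<Longrightarrow> cont_diff (\<lambda>x. \<Prod>i\<in>I. f i x :: real)"
  by (induction I rule: infinite_finite_induct) (auto intro: cont_diff_const cont_diff_mult)

lemma cont_diff_q1_map: "cont_diff (q1_map a)"
  unfolding q1_map_def[abs_def]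
  by (intro cont_diff_sum cont_diff_scaleR cont_diff_mult cont_diff_prod cont_diff_nth cont_diff_diff cont_diff_const)

lemma cont_diff_rt_space: "\<psi> \<in> rt_space \<Longrightarrow> cont_diff \<psi>"
  unfolding rt_space_def power2_eq_square
  by (auto intro!: cont_diff_sum cont_diff_add cont_diff_mult cont_diff_nth cont_diff_diff cont_diff_const)

(* By Cramer's rule, the inverse of the Jacobian matrix of the chart depends continuously on the
   point of the closed cube; this bounds the gradients up to the boundary of the cell. *)
lemma chart_composition_GDERIV:
  fixes K :: "(real^'d) set"
  assumes K: "open K" "q1_chart a K" and \<psi>: "cont_diff \<psi>"
    and z: "\<And>x. x \<in> closure K \<Longrightarrow> z x = \<psi> (inv_into (cbox 0 1) (q1_map a) x)"
  obtains G where "continuous_on (closure K) G" "\<And>x. x \<in> K \<Longrightarrow> GDERIV z x :> G x"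
proof -
  define f where "f = q1_map a"
  define g where "g = inv_into (cbox 0 1) f"
  obtain f' where f': "\<And>x. (f has_derivative f' x) (at x)" "\<And>v. continuous_on UNIV (\<lambda>x. f' x v)"
    using cont_diff_q1_map[of a] by (auto simp: cont_diff_def f_def)
  obtain \<psi>' where \<psi>': "\<And>x. (\<psi> has_derivative \<psi>' x) (at x)" "\<And>v. continuous_on UNIV (\<lambda>x. \<psi>' x v)"
    using \<psi> by (auto simp: cont_diff_def)
  have bij: "bij_betw f (cbox 0 1) (closure K)" using K by (simp add: q1_chart_def f_def)
  define J where "J = (\<lambda>\<xi>. matrix (f' \<xi>))"
  have fd: "frechet_derivative f (at x) = f' x" for x using frechet_derivative_at[OF f'(1)] by simp
  have det: "det (J \<xi>) \<noteq> 0" if "\<xi> \<in> cbox 0 1" for \<xi>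
    using K that fd unfolding q1_chart_def J_def f_def by auto
  \<comment> \<open>\<open>E k\<close> is the k-th column of the inverse Jacobian.\<close>
  define E where "E = (\<lambda>k \<xi>. \<chi> i. det (\<chi> r c. if c = i then axis k 1 $ r else J \<xi> $ r $ c) / det (J \<xi>))"
  have JE: "f' \<xi> (E k \<xi>) = axis k 1" if "\<xi> \<in> cbox 0 1" for k \<xi>
  proof -
    have "J \<xi> *v E k \<xi> = axis k 1" using cramer[OF det[OF that]] by (simp add: E_def)
    moreover have "linear (f' \<xi>)" using f'(1) has_derivative_linear by blast
    ultimately show ?thesis by (simp add: J_def matrix_works)
  qed
  \<comment> \<open>The transposed inverse Jacobian applied to the gradient of \<psi>: by the chain
    rule, the gradient on the cell expressed in cube coordinates.\<close>
  define H where "H = (\<lambda>\<xi>. \<chi> k. \<Sum>i\<in>UNIV. E k \<xi> $ i * \<psi>' \<xi> (axis i 1))"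
  have cJ: "continuous_on (cbox 0 1) (\<lambda>\<xi>. J \<xi> $ r $ c)" for r c
    unfolding J_def matrix_def
    by (auto intro!: continuous_intros continuous_on_subset[OF f'(2)])
  have cE: "continuous_on (cbox 0 1) (\<lambda>\<xi>. E k \<xi> $ i)" for k i
    unfolding E_def vec_lambda_beta
  proof (rule continuous_on_divide)
    show "continuous_on (cbox 0 1) (\<lambda>\<xi>. det (J \<xi>))"
      unfolding det_def by (intro continuous_intros cJ)
    have "continuous_on (cbox 0 1) (\<lambda>\<xi>. if c = i then axis k 1 $ r else J \<xi> $ r $ c)" for r c
      by (cases "c = i") (auto intro!: cJ)
    then show "continuous_on (cbox 0 1) (\<lambda>\<xi>. det (\<chi> r c. if c = i then axis k 1 $ r else J \<xi> $ r $ c))"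
      unfolding det_def vec_lambda_beta by (intro continuous_intros)
  qed (use det in auto)
  have cH: "continuous_on (cbox 0 1) H"
    unfolding H_def
    by (intro continuous_on_vec_lambda continuous_on_sum continuous_on_mult cE continuous_on_subset[OF \<psi>'(2)]) auto
  have "continuous_on (f ` cbox 0 1) g"
  proof (rule continuous_on_inv)
    show "continuous_on (cbox 0 1) f"
      using f'(1) by (meson has_derivative_continuous continuous_at_imp_continuous_on)
    show "\<forall>x\<in>cbox 0 1. g (f x) = x"
      using bij by (auto simp: g_def bij_betw_def inv_into_f_f)
  qed auto
  then have cg: "continuous_on (closure K) g" using bij by (simp add: bij_betw_def)
  have gin: "g x \<in> cbox 0 1" and fg: "f (g x) = x" if "x \<in> closure K" for x
    using bij that unfolding g_def bij_betw_def by (metis inv_into_into, metis f_inv_into_f)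
  show ?thesis
  proof
    show "continuous_on (closure K) (\<lambda>x. H (g x))"
      by (rule continuous_on_compose2[OF cH cg]) (use gin in auto)
    fix x assume x: "x \<in> K"
    then have xc: "x \<in> closure K" using closure_subset by blast
    define g' where "g' = (\<lambda>w :: real^'d. \<Sum>k\<in>UNIV. w $ k *\<^sub>R E k (g x))"
    have lg': "linear g'" unfolding g'_def
      by (intro linear_compose_sum ballI bounded_linear.linear[OF bounded_linear_scaleR_const] bounded_linear_vec_nth)
    have lf': "linear (f' (g x))" using f'(1) has_derivative_linear by blast
    have "f' (g x) \<circ> g' = id"
    proof
      fix w
      have "f' (g x) (g' w) = (\<Sum>k\<in>UNIV. w $ k *\<^sub>R axis k 1)"
        unfolding g'_def by (simp add: linear_sum[OF lf'] linear_cmul[OF lf'] JE[OF gin[OF xc]])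
      also have "\<dots> = w" using basis_expansion[of w] by (simp add: scalar_mult_eq_scaleR)
      finally show "(f' (g x) \<circ> g') w = id w" by simp
    qed
    \<comment> \<open>In equal finite dimensions the right inverse assembled from the columns is
      also a left inverse, which is the form the inverse function rule asks for.\<close>
    then have id: "g' \<circ> f' (g x) = id" using linear_inverse_left[OF lf' lg'] by simp
    have "(g has_derivative g') (at x)"
    proof (rule has_derivative_inverse_basic[where f=f and f'="f' (g x)" and T=K])
      show "(f has_derivative f' (g x)) (at (g x))" "g' \<circ> f' (g x) = id" "open K" "x \<in> K"
        using f'(1) id K(1) x by auto
      show "bounded_linear g'" using lg' linear_conv_bounded_linear by blast
      show "continuous (at x) g"
        using continuous_on_subset[OF cg closure_subset] x K(1) by (simp add: continuous_on_eq_continuous_at)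
      show "\<And>y. y \<in> K \<Longrightarrow> f (g y) = y" using fg closure_subset by blast
    qed
    from has_derivative_compose[OF this \<psi>'(1)]
    have "((\<lambda>x. \<psi> (g x)) has_derivative (\<lambda>w. \<psi>' (g x) (g' w))) (at x)" .
    moreover have "\<psi>' (g x) (g' w) = w \<bullet> H (g x)" for w
    proof -
      have l: "linear (\<psi>' (g x))" using \<psi>'(1) has_derivative_linear by blast
      have expand: "\<psi>' (g x) v = (\<Sum>i\<in>UNIV. v $ i * \<psi>' (g x) (axis i 1))" for v
      proof -
        have "\<psi>' (g x) v = \<psi>' (g x) (\<Sum>i\<in>UNIV. v $ i *\<^sub>R axis i 1)"
          using basis_expansion[of v] by (simp add: scalar_mult_eq_scaleR)
        then show ?thesis by (simp add: linear_sum[OF l] linear_cmul[OF l])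
      qed
      have "H (g x) $ k = \<psi>' (g x) (E k (g x))" for k
        unfolding H_def vec_lambda_beta by (rule expand[symmetric])
      then show ?thesis
        unfolding g'_def by (simp add: linear_sum[OF l] linear_cmul[OF l] inner_vec_def)
    qed
    ultimately have "((\<lambda>x. \<psi> (g x)) has_derivative (\<lambda>w. w \<bullet> H (g x))) (at x)" by simp
    then have "(z has_derivative (\<lambda>w. w \<bullet> H (g x))) (at x)"
      by (rule has_derivative_transform_within_open[OF _ K(1) x])
         (simp add: g_def f_def z subsetD[OF closure_subset])
    then show "GDERIV z x :> H (g x)" by (simp add: gderiv_def)
  qed
qed

section \<open>Gradients of shape functions and expansion of the broken norm\<close>

lemma grad_eq: "GDERIV f x :> D \<Longrightarrow> grad f x = D"
  unfolding grad_def
proof (rule the_equality)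
  fix E assume "GDERIV f x :> D" "GDERIV f x :> E"
  then have "(\<lambda>h. h \<bullet> D) = (\<lambda>h. h \<bullet> E)" unfolding gderiv_def by (rule has_derivative_unique)
  then have "h \<bullet> (E - D) = 0" for h by (metis inner_diff_right right_minus_eq)
  then have "(E - D) \<bullet> (E - D) = 0" .
  then show "E = D" by simp
qed

text \<open>One representative of the gradient serves for every face. It is identically zero for
  faces of other cells, so those drop out of the sum over all mesh faces in
  \<open>broken_norm\<close>. Continuity on the closure, not only on the open cell, is what yields
  integrability.\<close>

lemma shape_grad:
  fixes K :: "(real^'d) set"
  assumes sh: "rt_shape_functions M \<zeta>" and K: "K \<in> M" "mesh_cell K"
  obtains G where "continuous_on (closure K) G" "\<And>x. x \<in> K \<Longrightarrow> GDERIV (\<zeta> K \<sigma>) x :> G x"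
    "\<sigma> \<notin> faces K \<Longrightarrow> G = (\<lambda>x. 0)"
proof (cases "\<sigma> \<in> faces K")
  case True
  then obtain a \<psi> where a: "q1_chart a K" "\<psi> \<in> rt_space"
    and eq: "\<And>x. x \<in> closure K \<Longrightarrow> \<zeta> K \<sigma> x = \<psi> (inv_into (cbox 0 1) (q1_map a) x)"
    using sh K unfolding rt_shape_functions_def by blast
  have "open K" using K by (simp add: mesh_cell_def)
  obtain G where G: "continuous_on (closure K) G" "\<And>x. x \<in> K \<Longrightarrow> GDERIV (\<zeta> K \<sigma>) x :> G x"
    using chart_composition_GDERIV[OF \<open>open K\<close> a(1) cont_diff_rt_space[OF a(2)] eq] by blast
  show ?thesis by (rule that[of G]) (simp_all add: G True)
next
  case False
  have D: "GDERIV (\<zeta> K \<sigma>) x :> 0" if "x \<in> K" for x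
  proof -
    have 0: "0 = \<zeta> K \<sigma> y" if "y \<in> K" for y
      using sh K(1) False subsetD[OF closure_subset that] unfolding rt_shape_functions_def by metis
    have "open K" using K(2) by (simp add: mesh_cell_def)
    from has_derivative_transform_within_open[OF has_derivative_const this that 0]
    have "(\<zeta> K \<sigma> has_derivative (\<lambda>h. 0)) (at x)" .
    then show ?thesis by (simp add: gderiv_def)
  qed
  show ?thesis by (rule that[of "\<lambda>x. 0"]) (simp_all add: D)
qed

text \<open>Squared Frobenius norm of the Jacobian of a combination of shape functions: for each
  component j the square is a Gram expansion, and summing over j contracts the coefficients to inner
  products.\<close>

lemma sum_norm_sq_components:
  fixes G :: "'i \<Rightarrow> real^'d" and u :: "'i \<Rightarrow> real^'e"
  shows "(\<Sum>j\<in>UNIV. (norm (\<Sum>s\<in>F. (u s $ j) *\<^sub>R G s))\<^sup>2) = (\<Sum>s\<in>F. \<Sum>s'\<in>F. (G s' \<bullet> G s) * (u s \<bullet> u s'))"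
proof -
  have "(\<Sum>j\<in>UNIV. (norm (\<Sum>s\<in>F. (u s $ j) *\<^sub>R G s))\<^sup>2) =
      (\<Sum>j\<in>UNIV. \<Sum>s\<in>F. \<Sum>s'\<in>F. (G s' \<bullet> G s) * (u s $ j * u s' $ j))"
    unfolding power2_norm_eq_inner inner_sum_left inner_sum_right
    by (intro sum.cong refl) (simp add: inner_commute mult_ac)
  also have "\<dots> = (\<Sum>s\<in>F. \<Sum>j\<in>UNIV. \<Sum>s'\<in>F. (G s' \<bullet> G s) * (u s $ j * u s' $ j))"
    by (rule sum.swap)
  also have "\<dots> = (\<Sum>s\<in>F. \<Sum>s'\<in>F. \<Sum>j\<in>UNIV. (G s' \<bullet> G s) * (u s $ j * u s' $ j))"
    by (intro sum.cong refl sum.swap)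
  finally show ?thesis by (simp add: inner_vec_def sum_distrib_left)
qed

text \<open>The right side is the stiffness form that appears when \<open>neg_laplacian\<close> is
  tested with \<open>u\<close>; the identity turns the diffusion term into a square.\<close>

lemma broken_norm_sq:
  fixes M :: "(real^'d) set set" and u :: "'d vectors"
  assumes sh: "rt_shape_functions M \<zeta>" and M: "finite M" "\<And>K. K \<in> M \<Longrightarrow> mesh_cell K"
  shows "(broken_norm M \<zeta> u)\<^sup>2 = (\<Sum>K\<in>M. \<Sum>\<sigma>\<in>mesh_faces M.
    u \<sigma> \<bullet> (\<Sum>\<sigma>'\<in>faces K. (LINT x:K|lebesgue. grad (\<zeta> K \<sigma>') x \<bullet> grad (\<zeta> K \<sigma>) x) *\<^sub>R u \<sigma>'))"
proof -
  let ?F = "mesh_faces M"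
  let ?I = "\<lambda>K \<sigma> \<sigma>'. LINT x:K|lebesgue. grad (\<zeta> K \<sigma>') x \<bullet> grad (\<zeta> K \<sigma>) x"
  have finF: "finite ?F" using M mesh_cell_finite_faces by (auto simp: mesh_faces_def)
  have cell: "(LINT x:K|lebesgue.
      (\<Sum>j\<in>UNIV. (norm (grad (\<lambda>y. (\<Sum>\<sigma>\<in>?F. \<zeta> K \<sigma> y *\<^sub>R u \<sigma>) $ j) x))\<^sup>2)) =
      (\<Sum>\<sigma>\<in>?F. u \<sigma> \<bullet> (\<Sum>\<sigma>'\<in>faces K. ?I K \<sigma> \<sigma>' *\<^sub>R u \<sigma>'))" if K: "K \<in> M" for K
  proof -
    have oK: "open K" using M(2)[OF K] by (simp add: mesh_cell_def)
    have "\<forall>\<sigma>. \<exists>G. continuous_on (closure K) G \<and> (\<forall>x\<in>K. GDERIV (\<zeta> K \<sigma>) x :> G x) \<and>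
        (\<sigma> \<notin> faces K \<longrightarrow> G = (\<lambda>x. 0))"
      using shape_grad[OF sh K M(2)[OF K]] by metis
    then obtain G where G: "\<And>\<sigma>. continuous_on (closure K) (G \<sigma>)"
      "\<And>\<sigma> x. x \<in> K \<Longrightarrow> GDERIV (\<zeta> K \<sigma>) x :> G \<sigma> x" "\<And>\<sigma>. \<sigma> \<notin> faces K \<Longrightarrow> G \<sigma> = (\<lambda>x. 0)"
      by metis
    have Kl: "K \<in> sets lebesgue" using oK by auto
    have I: "?I K \<sigma> \<sigma>' = (LINT x:K|lebesgue. G \<sigma>' x \<bullet> G \<sigma> x)" for \<sigma> \<sigma>'
      by (rule set_lebesgue_integral_cong[OF Kl]) (simp add: grad_eq[OF G(2)])
    \<comment> \<open>Splitting the integral of the double sum requires each product to be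
      integrable. It is continuous on the compact closure, and restriction to the open cell
      preserves integrability.\<close>
    have int: "set_integrable lebesgue K (\<lambda>x. (G \<sigma>' x \<bullet> G \<sigma> x) * c)" for \<sigma> \<sigma>' c
    proof -
      have "integrable lborel (\<lambda>x. indicat_real (closure K) x *\<^sub>R ((G \<sigma>' x \<bullet> G \<sigma> x) * c))"
        by (intro borel_integrable_compact mesh_cellD(5)[OF M(2)[OF K]] continuous_intros G(1))
      then have "set_integrable lebesgue (closure K) (\<lambda>x. (G \<sigma>' x \<bullet> G \<sigma> x) * c)"
        unfolding set_integrable_def using integrable_completion[OF borel_measurable_integrable] by blast
      then show ?thesis by (rule set_integrable_subset) (use Kl closure_subset in auto)
    qed
    have gr: "grad (\<lambda>y. (\<Sum>\<sigma>\<in>?F. \<zeta> K \<sigma> y *\<^sub>R u \<sigma>) $ j) x = (\<Sum>\<sigma>\<in>?F. (u \<sigma> $ j) *\<^sub>R G \<sigma> x)"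
      if "x \<in> K" for x j
    proof (rule grad_eq)
      have "((\<lambda>y. \<Sum>\<sigma>\<in>?F. \<zeta> K \<sigma> y * u \<sigma> $ j) has_derivative
          (\<lambda>h. \<Sum>\<sigma>\<in>?F. (h \<bullet> G \<sigma> x) * u \<sigma> $ j)) (at x)"
        using G(2)[OF that] by (auto simp: gderiv_def intro!: has_derivative_sum has_derivative_mult_left)
      then show "GDERIV (\<lambda>y. (\<Sum>\<sigma>\<in>?F. \<zeta> K \<sigma> y *\<^sub>R u \<sigma>) $ j) x :> (\<Sum>\<sigma>\<in>?F. (u \<sigma> $ j) *\<^sub>R G \<sigma> x)"
        by (simp add: gderiv_def inner_sum_right mult.commute)
    qed
    have "(LINT x:K|lebesgue.
        (\<Sum>j\<in>UNIV. (norm (grad (\<lambda>y. (\<Sum>\<sigma>\<in>?F. \<zeta> K \<sigma> y *\<^sub>R u \<sigma>) $ j) x))\<^sup>2)) =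
        (LINT x:K|lebesgue. \<Sum>\<sigma>\<in>?F. \<Sum>\<sigma>'\<in>?F. (G \<sigma>' x \<bullet> G \<sigma> x) * (u \<sigma> \<bullet> u \<sigma>'))"
      by (rule set_lebesgue_integral_cong[OF Kl], intro allI impI) (simp only: gr sum_norm_sq_components)
    also have "\<dots> = (\<Sum>\<sigma>\<in>?F. \<Sum>\<sigma>'\<in>?F. LINT x:K|lebesgue. (G \<sigma>' x \<bullet> G \<sigma> x) * (u \<sigma> \<bullet> u \<sigma>'))"
    proof -
      define h where "h = (\<lambda>\<sigma> \<sigma>' x. indicat_real K x *\<^sub>R ((G \<sigma>' x \<bullet> G \<sigma> x) * (u \<sigma> \<bullet> u \<sigma>')))"
      have "integrable lebesgue (h \<sigma> \<sigma>')" for \<sigma> \<sigma>' using int by (simp add: h_def set_integrable_def)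
      then have "(LINT x|lebesgue. (\<Sum>\<sigma>\<in>?F. \<Sum>\<sigma>'\<in>?F. h \<sigma> \<sigma>' x)) = (\<Sum>\<sigma>\<in>?F. \<Sum>\<sigma>'\<in>?F. (LINT x|lebesgue. h \<sigma> \<sigma>' x))"
        by simp
      then show ?thesis unfolding set_lebesgue_integral_def scaleR_sum_right h_def .
    qed
    also have "\<dots> = (\<Sum>\<sigma>\<in>?F. \<Sum>\<sigma>'\<in>?F. ?I K \<sigma> \<sigma>' * (u \<sigma> \<bullet> u \<sigma>'))"
      by (simp add: I)
    also have "\<dots> = (\<Sum>\<sigma>\<in>?F. \<Sum>\<sigma>'\<in>faces K. ?I K \<sigma> \<sigma>' * (u \<sigma> \<bullet> u \<sigma>'))"
    proof (rule sum.cong[OF refl], rule sum.mono_neutral_right[OF finF])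
      show "faces K \<subseteq> ?F" using K by (auto simp: mesh_faces_def)
      show "\<forall>\<sigma>'\<in>?F - faces K. ?I K \<sigma> \<sigma>' * (u \<sigma> \<bullet> u \<sigma>') = 0" for \<sigma>
        unfolding I by (simp add: G(3) set_lebesgue_integral_def)
    qed
    finally show ?thesis by (simp add: inner_sum_right)
  qed
  \<comment> \<open>The square undoes \<open>sqrt\<close> once its argument is known to be
    nonnegative.\<close>
  have nonneg: "0 \<le> (\<Sum>K\<in>M. LINT x:K|lebesgue. (\<Sum>j\<in>UNIV. (norm (grad (\<lambda>y. (\<Sum>\<sigma>\<in>?F. \<zeta> K \<sigma> y *\<^sub>R u \<sigma>) $ j) x))\<^sup>2))"
    unfolding set_lebesgue_integral_def
    by (intro sum_nonneg Bochner_Integration.integral_nonneg scaleR_nonneg_nonneg) auto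
  show ?thesis unfolding broken_norm_def real_sqrt_pow2[OF nonneg] by (intro sum.cong refl cell)
qed

section \<open>Integral averages and time steps\<close>

text \<open>With c the average of f, integrate 2 c.f - |c|^2 \<le> |f|^2 over \<open>A\<close>: the
  left side yields vol A times |c|^2. Members of \<open>F\<close> may overlap, since extra
  occurrences only increase the right side. Later \<open>A\<close> is a dual cell and
  \<open>F\<close> consists of the two primal cells next to it.\<close>

lemma average_sq_le:
  fixes f :: "real^'d \<Rightarrow> real^'d"
  assumes A: "A \<in> lmeasurable" "0 < vol A" and F: "finite F"
    and int: "\<And>K. K \<in> F \<Longrightarrow> set_integrable lebesgue K (\<lambda>x. (norm (f x))\<^sup>2)"
    and neg: "negligible (A - \<Union>F)"
  shows "vol A * (norm ((1 / vol A) *\<^sub>R (LINT x:A|lebesgue. f x)))\<^sup>2 \<le> (\<Sum>K\<in>F. LINT x:K|lebesgue. (norm (f x))\<^sup>2)"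
proof (cases "set_integrable lebesgue A f")
  \<comment> \<open>The Bochner integral is then 0 by convention, and the average with it.\<close>
  case False
  then have "(LINT x:A|lebesgue. f x) = 0"
    unfolding set_lebesgue_integral_def set_integrable_def by (rule not_integrable_integral_eq)
  then show ?thesis by (auto intro!: sum_nonneg Bochner_Integration.integral_nonneg simp: set_lebesgue_integral_def)
next
  case True
  define c where "c = (1 / vol A) *\<^sub>R (LINT x:A|lebesgue. f x)"
  have I: "(LINT x:A|lebesgue. f x) = vol A *\<^sub>R c" using A by (simp add: c_def)
  have i1: "set_integrable lebesgue A (\<lambda>x. 2 * (c \<bullet> f x))"
    using integrable_inner_right[of "2 *\<^sub>R c" lebesgue "\<lambda>x. indicat_real A x *\<^sub>R f x"] True
    by (simp add: set_integrable_def mult.left_commute)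
  have i2: "set_integrable lebesgue A (\<lambda>x. (norm c)\<^sup>2)"
    using A unfolding set_integrable_def
    by (intro integrable_scaleR_left impI) (simp add: lmeasurable_iff_integrable)
  have i3: "integrable lebesgue (\<lambda>x. \<Sum>K\<in>F. indicat_real K x *\<^sub>R (norm (f x))\<^sup>2)"
    using int by (intro Bochner_Integration.integrable_sum) (simp add: set_integrable_def)
  have "2 * (c \<bullet> (LINT x:A|lebesgue. f x)) = (LINT x:A|lebesgue. 2 * (c \<bullet> f x))"
  proof -
    have "c \<bullet> (LINT x:A|lebesgue. f x) = (LINT x|lebesgue. c \<bullet> (indicat_real A x *\<^sub>R f x))"
      unfolding set_lebesgue_integral_def
      by (rule integral_inner_right[symmetric]) (use True in \<open>simp add: set_integrable_def\<close>)
    then show ?thesis by (simp add: set_lebesgue_integral_def mult.left_commute)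
  qed
  moreover have "vol A * (norm c)\<^sup>2 = (LINT x:A|lebesgue. (norm c)\<^sup>2)"
    using A by (simp add: set_lebesgue_integral_def vol_def mult.commute)
  moreover have "2 * (c \<bullet> (LINT x:A|lebesgue. f x)) = 2 * (vol A * (norm c)\<^sup>2)"
    unfolding I by (simp add: power2_norm_eq_inner)
  ultimately have "vol A * (norm c)\<^sup>2 = (LINT x:A|lebesgue. 2 * (c \<bullet> f x)) - (LINT x:A|lebesgue. (norm c)\<^sup>2)"
    by linarith
  also have "\<dots> = (LINT x:A|lebesgue. 2 * (c \<bullet> f x) - (norm c)\<^sup>2)"
    by (rule set_integral_diff(2)[OF i1 i2, symmetric])
  also have "\<dots> \<le> (LINT x|lebesgue. (\<Sum>K\<in>F. indicat_real K x *\<^sub>R (norm (f x))\<^sup>2))"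
    unfolding set_lebesgue_integral_def
  proof (rule integral_mono_AE[OF _ i3])
    show "integrable lebesgue (\<lambda>x. indicat_real A x *\<^sub>R (2 * (c \<bullet> f x) - (norm c)\<^sup>2))"
      using set_integral_diff(1)[OF i1 i2] by (simp add: set_integrable_def)
    have "AE x in lebesgue. x \<notin> A - \<Union>F"
      using neg by (intro AE_not_in) (simp add: negligible_iff_null_sets)
    then show "AE x in lebesgue. indicat_real A x *\<^sub>R (2 * (c \<bullet> f x) - (norm c)\<^sup>2)
        \<le> (\<Sum>K\<in>F. indicat_real K x *\<^sub>R (norm (f x))\<^sup>2)"
    proof eventually_elim
      fix x assume x: "x \<notin> A - \<Union>F"
      show "indicat_real A x *\<^sub>R (2 * (c \<bullet> f x) - (norm c)\<^sup>2) \<le> (\<Sum>K\<in>F. indicat_real K x *\<^sub>R (norm (f x))\<^sup>2)"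
      proof (cases "x \<in> A")
        case True
        then obtain K where K: "K \<in> F" "x \<in> K" using x by auto
        have "0 \<le> (norm (f x - c))\<^sup>2" by simp
        then have "2 * (c \<bullet> f x) - (norm c)\<^sup>2 \<le> (norm (f x))\<^sup>2"
          by (simp add: power2_norm_eq_inner inner_diff_left inner_diff_right inner_commute)
        also have "\<dots> = indicat_real K x *\<^sub>R (norm (f x))\<^sup>2" using K by simp
        also have "\<dots> \<le> (\<Sum>K\<in>F. indicat_real K x *\<^sub>R (norm (f x))\<^sup>2)"
          by (rule member_le_sum[OF K(1) _ F]) simp
        finally show ?thesis using True by simp
      qed (simp add: sum_nonneg)
    qed
  qed
  also have "\<dots> = (\<Sum>K\<in>F. LINT x:K|lebesgue. (norm (f x))\<^sup>2)"
    unfolding set_lebesgue_integral_def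
    by (rule Bochner_Integration.integral_sum) (use int in \<open>simp add: set_integrable_def\<close>)
  finally show ?thesis unfolding c_def .
qed

lemma time_index_range:
  assumes "0 < t" "t \<le> T" "1 \<le> N" "dt = T / real N"
  shows "time_index dt t \<in> {1..N}"
proof -
  have dt: "0 < dt" using assms by simp
  have "t / dt \<le> real N" using assms dt by (simp add: pos_divide_le_eq)
  then have "\<lceil>t / dt\<rceil> \<le> int N" by (simp add: ceiling_le_iff)
  moreover have "0 < t / dt" using assms dt by simp
  then have "0 < \<lceil>t / dt\<rceil>" by simp
  ultimately show ?thesis unfolding time_index_def by (simp add: le_nat_iff nat_le_iff)
qed

text \<open>The function \<open>h\<close> is arbitrary because it is evaluated along a measurable
  map into a countable discrete space. This makes the time profile of the spatial norm admissible
  for \<open>esssup_I\<close>.\<close>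

lemma measurable_time_index: "(\<lambda>t. h (time_index dt t) :: ereal) \<in> borel_measurable borel"
proof (rule measurable_compose_countable)
  show "time_index dt \<in> measurable borel (count_space UNIV)"
    unfolding time_index_def by measurable
qed simp

section \<open>Estimates for one time step\<close>

lemma interface_commute: "interface M \<sigma> K L \<Longrightarrow> interface M \<sigma> L K"
  by (auto simp: interface_def)

locale staggered_mesh =
  fixes \<Omega> :: "(real^'d) set" and M :: "(real^'d) set set" and D :: "'d subvols"
  assumes domain: "polyhedral_domain \<Omega>" and staggered: "staggered \<Omega> M D"
begin

section \<open>Incidence of cells and faces, volumes of the dual cells\<close>

lemma finite_cells: "finite M"
  and cell: "K \<in> M \<Longrightarrow> mesh_cell K"
  and cells_disjnt: "K \<in> M \<Longrightarrow> L \<in> M \<Longrightarrow> K \<noteq> L \<Longrightarrow> disjnt K L"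
  and closure_domain: "closure \<Omega> = (\<Union>K\<in>M. closure K)"
  and subvol: "K \<in> M \<Longrightarrow> subvolumes K (D K)"
  using staggered by (auto simp: staggered_def primal_mesh_def pairwise_def)

lemma vol_pos: "K \<in> M \<Longrightarrow> 0 < vol K"
  using mesh_cellD(8) cell by blast

lemma finite_faces: "K \<in> M \<Longrightarrow> finite (faces K)"
  using mesh_cell_finite_faces cell by blast

lemma finite_mesh_faces: "finite (mesh_faces M)"
  using finite_cells finite_faces by (auto simp: mesh_faces_def)

lemma finite_face_cells: "finite (face_cells M \<sigma>)"
  using finite_cells by (simp add: face_cells_def)

lemma interface_exists: "\<sigma> \<in> int_faces \<Omega> M \<Longrightarrow> \<exists>K L. interface M \<sigma> K L"
  using staggered by (auto simp: int_faces_def ext_faces_def staggered_def primal_mesh_def)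

lemma face_cells_interface:
  assumes "interface M \<sigma> K L" shows "face_cells M \<sigma> = {K, L}"
proof -
  have KL: "K \<in> M" "L \<in> M" "K \<noteq> L" "\<sigma> \<in> faces K" "\<sigma> \<in> faces L" using assms by (auto simp: interface_def)
  have "N = K \<or> N = L" if "N \<in> M" "\<sigma> \<in> faces N" for N
    using at_most_two_cells[OF cell[OF that(1)] cell[OF KL(1)] cell[OF KL(2)] that(2) KL(4,5)]
      cells_disjnt that KL by blast
  with KL show ?thesis by (auto simp: face_cells_def)
qed

lemma neighbour_eq:
  assumes "interface M \<sigma> K L" shows "neighbour M K \<sigma> = L"
  unfolding neighbour_def
proof (rule the_equality)
  show "interface M \<sigma> K L" by (rule assms)
  fix N assume N: "interface M \<sigma> K N"
  then have "N \<in> face_cells M \<sigma>" by (auto simp: face_cells_def interface_def)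
  with N show "N = L" using face_cells_interface[OF assms] by (auto simp: interface_def)
qed

lemma sum_face_cells_interface:
  "interface M \<sigma> K L \<Longrightarrow> (\<Sum>N\<in>face_cells M \<sigma>. h N) = h K + h L"
  by (subst face_cells_interface, assumption, subst sum.insert) (simp_all add: interface_def)

lemma normal_interface:
  "interface M \<sigma> K L \<Longrightarrow> outer_normal L \<sigma> = - outer_normal K \<sigma>"
  by (rule outer_normal_opposite) (auto simp: interface_def intro: cell cells_disjnt)

lemma sum_cells_faces:
  "(\<Sum>K\<in>M. \<Sum>\<sigma>\<in>faces K. h K \<sigma>) = (\<Sum>\<sigma>\<in>mesh_faces M. \<Sum>K\<in>face_cells M \<sigma>. h K \<sigma>)"
proof -
  have "(\<Sum>K\<in>M. \<Sum>\<sigma>\<in>faces K. h K \<sigma>) = (\<Sum>K\<in>M. \<Sum>\<sigma>\<in>{\<sigma>\<in>mesh_faces M. \<sigma> \<in> faces K}. h K \<sigma>)"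
    by (intro sum.cong refl) (auto simp: mesh_faces_def)
  also have "\<dots> = (\<Sum>\<sigma>\<in>mesh_faces M. \<Sum>K\<in>{K\<in>M. \<sigma> \<in> faces K}. h K \<sigma>)"
    by (rule sum.swap_restrict) (use finite_cells finite_mesh_faces in auto)
  finally show ?thesis by (simp add: face_cells_def)
qed

text \<open>The discrete integration by parts: every balance below is regrouped from cells to
  internal faces in this way, the boundary terms vanishing because the velocity does.\<close>

lemma sum_cells_int_faces:
  assumes "\<And>K \<sigma>. K \<in> M \<Longrightarrow> \<sigma> \<in> faces K \<Longrightarrow> \<sigma> \<in> ext_faces \<Omega> M \<Longrightarrow> h K \<sigma> = 0"
  shows "(\<Sum>K\<in>M. \<Sum>\<sigma>\<in>faces K. h K \<sigma>) = (\<Sum>\<sigma>\<in>int_faces \<Omega> M. \<Sum>K\<in>face_cells M \<sigma>. h K \<sigma>)"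
  unfolding sum_cells_faces
  by (rule sum.mono_neutral_right[OF finite_mesh_faces])
     (auto simp: int_faces_def face_cells_def assms intro!: sum.neutral)

lemma vol_subvol: "K \<in> M \<Longrightarrow> \<sigma> \<in> faces K \<Longrightarrow> vol (D K \<sigma>) = vol K / (2 * real CARD('d))"
  using subvol by (auto simp: subvolumes_def)

lemma compact_subvol: "K \<in> M \<Longrightarrow> \<sigma> \<in> faces K \<Longrightarrow> compact (D K \<sigma>)"
  using subvol by (simp add: subvolumes_def)

lemma subvol_subset: "K \<in> M \<Longrightarrow> \<sigma> \<in> faces K \<Longrightarrow> D K \<sigma> \<subseteq> closure K"
  using subvol[of K] UN_upper[of \<sigma> "faces K" "D K"] by (simp add: subvolumes_def)

lemma lmeasurable_dual_cell: "dual_cell M D \<sigma> \<in> lmeasurable"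
  unfolding dual_cell_def
  by (intro fmeasurable.finite_UN lmeasurable_compact compact_subvol finite_face_cells) (auto simp: face_cells_def)

lemma vol_subvol_le_dual_cell:
  assumes "K \<in> M" "\<sigma> \<in> faces K" shows "vol (D K \<sigma>) \<le> vol (dual_cell M D \<sigma>)"
  unfolding vol_def
proof (rule measure_mono_fmeasurable[OF _ _ lmeasurable_dual_cell])
  show "D K \<sigma> \<subseteq> dual_cell M D \<sigma>" using assms by (auto simp: dual_cell_def face_cells_def)
  show "D K \<sigma> \<in> sets lebesgue" using compact_subvol[OF assms] by (simp add: lmeasurable_compact fmeasurableD)
qed

lemma vol_dual_cell_pos:
  assumes "\<sigma> \<in> mesh_faces M" shows "0 < vol (dual_cell M D \<sigma>)"
proof -
  obtain K where "K \<in> M" "\<sigma> \<in> faces K" using assms by (auto simp: mesh_faces_def)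
  moreover from this have "0 < vol (D K \<sigma>)" by (simp add: vol_subvol vol_pos)
  ultimately show ?thesis using vol_subvol_le_dual_cell[of K \<sigma>] by linarith
qed

section \<open>Volume and mass fluxes through internal faces\<close>

definition face_flow :: "'d vectors \<Rightarrow> (real^'d) set \<Rightarrow> (real^'d) set \<Rightarrow> real" where
  "face_flow u K \<sigma> = area \<sigma> * (u \<sigma> \<bullet> outer_normal K \<sigma>)"

lemma face_flow_interface: "interface M \<sigma> K L \<Longrightarrow> face_flow u L \<sigma> = - face_flow u K \<sigma>"
  by (simp add: face_flow_def normal_interface)

lemma sum_face_flow:
  assumes "discrete_div u K = 0" "K \<in> M" shows "(\<Sum>\<sigma>\<in>faces K. face_flow u K \<sigma>) = 0"
  using assms vol_pos[of K] by (auto simp: discrete_div_def face_flow_def)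

lemma area_nonneg: "0 \<le> area \<sigma>"
  by (simp add: area_def)

lemma primal_flux_eq:
  assumes "\<And>\<sigma>. \<sigma> \<in> ext_faces \<Omega> M \<Longrightarrow> u \<sigma> = 0"
  shows "primal_flux \<Omega> M \<rho> u K \<sigma> = upwind_density M \<rho> u K \<sigma> * face_flow u K \<sigma>"
  using assms by (auto simp: primal_flux_def face_flow_def)

text \<open>The density is stated only multiplied by the flow. When the normal velocity is 0, both
  cells take themselves as upwind cell and the densities may disagree; the products still match
  because the flow vanishes.\<close>

lemma upwind_density_interface:
  assumes "interface M \<sigma> K L"
  shows "upwind_density M \<rho> u K \<sigma> * face_flow u K \<sigma> =
    (if 0 \<le> u \<sigma> \<bullet> outer_normal K \<sigma> then \<rho> K else \<rho> L) * face_flow u K \<sigma>"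
    "upwind_density M \<rho> u L \<sigma> * face_flow u L \<sigma> =
    - (if 0 \<le> u \<sigma> \<bullet> outer_normal K \<sigma> then \<rho> K else \<rho> L) * face_flow u K \<sigma>"
  using neighbour_eq[OF assms] neighbour_eq[OF interface_commute[OF assms]] normal_interface[OF assms]
  by (auto simp: upwind_density_def face_flow_def)

lemma primal_flux_interface:
  assumes "\<And>\<sigma>. \<sigma> \<in> ext_faces \<Omega> M \<Longrightarrow> u \<sigma> = 0" "interface M \<sigma> K L"
  shows "primal_flux \<Omega> M \<rho> u L \<sigma> = - primal_flux \<Omega> M \<rho> u K \<sigma>"
  using primal_flux_eq[OF assms(1)] by (simp add: upwind_density_interface[OF assms(2)])

section \<open>Discrete maximum principle\<close>

lemma interface_of_face:
  assumes "K \<in> M" "\<sigma> \<in> faces K" "\<sigma> \<notin> ext_faces \<Omega> M"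
  obtains L where "interface M \<sigma> K L"
proof -
  have "\<sigma> \<in> int_faces \<Omega> M" using assms by (auto simp: int_faces_def mesh_faces_def)
  then obtain N L where NL: "interface M \<sigma> N L" using interface_exists by blast
  have "K \<in> face_cells M \<sigma>" using assms by (simp add: face_cells_def)
  then have "K = N \<or> K = L" unfolding face_cells_interface[OF NL] by simp
  then show ?thesis using that NL interface_commute by blast
qed

text \<open>The balance is evaluated only at a cell where the new density is least. There the net
  mass flux is nonpositive, so the density has not dropped below its old value, and no other cell
  can do worse.\<close>

lemma density_lower_bound:
  assumes ext: "\<And>\<sigma>. \<sigma> \<in> ext_faces \<Omega> M \<Longrightarrow> u \<sigma> = 0" and dt: "0 < dt"
    and mass: "\<And>K. K \<in> M \<Longrightarrow> (1 / dt) * (\<rho> K - \<rho>' K) +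
             (1 / vol K) * (\<Sum>\<sigma>\<in>faces K. primal_flux \<Omega> M \<rho> u K \<sigma>) = 0"
    and dv: "\<And>K. K \<in> M \<Longrightarrow> discrete_div u K = 0"
    and low: "\<And>K. K \<in> M \<Longrightarrow> m \<le> \<rho>' K" and N: "N \<in> M"
  shows "m \<le> \<rho> N"
proof -
  define K where "K = arg_min_on \<rho> M"
  have K: "K \<in> M" "\<And>L. L \<in> M \<Longrightarrow> \<rho> K \<le> \<rho> L"
    using arg_min_if_finite[OF finite_cells, of \<rho>] N unfolding K_def by force+
  \<comment> \<open>Incompressibility permits subtracting \<open>\<rho> K\<close> times the total
    outflow. An outflow face then contributes 0, and an inflow face the difference \<rho>_L -
    \<rho>_K times a negative flow, which is nonpositive at the minimum.\<close>
  have "(\<Sum>\<sigma>\<in>faces K. primal_flux \<Omega> M \<rho> u K \<sigma>) =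
      (\<Sum>\<sigma>\<in>faces K. primal_flux \<Omega> M \<rho> u K \<sigma> - \<rho> K * face_flow u K \<sigma>)"
    using sum_face_flow[OF dv[OF K(1)] K(1)] by (simp add: sum_subtractf flip: sum_distrib_left)
  also have "\<dots> \<le> 0"
  proof (rule sum_nonpos)
    fix \<sigma> assume \<sigma>: "\<sigma> \<in> faces K"
    show "primal_flux \<Omega> M \<rho> u K \<sigma> - \<rho> K * face_flow u K \<sigma> \<le> 0"
    proof (cases "\<sigma> \<in> ext_faces \<Omega> M")
      case True
      then show ?thesis using ext by (simp add: primal_flux_def face_flow_def)
    next
      case False
      then obtain L where L: "interface M \<sigma> K L" using interface_of_face K \<sigma> by blast
      then have "\<rho> K \<le> \<rho> L" using K by (auto simp: interface_def)
      then have "(\<rho> L - \<rho> K) * face_flow u K \<sigma> \<le> 0" if "\<not> 0 \<le> u \<sigma> \<bullet> outer_normal K \<sigma>"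
        using that area_nonneg[of \<sigma>] by (simp add: face_flow_def mult_nonneg_nonpos)
      then show ?thesis
        using upwind_density_interface(1)[OF L, of \<rho> u] primal_flux_eq[OF ext]
        by (auto simp: algebra_simps)
    qed
  qed
  finally have "(1 / vol K) * (\<Sum>\<sigma>\<in>faces K. primal_flux \<Omega> M \<rho> u K \<sigma>) \<le> 0"
    using vol_pos[OF K(1)] by (simp add: divide_nonpos_pos)
  then have "0 \<le> (1 / dt) * (\<rho> K - \<rho>' K)" using mass[OF K(1)] by linarith
  then have "\<rho>' K \<le> \<rho> K" using dt by (simp add: zero_le_divide_iff)
  then show ?thesis using low[OF K(1)] K(2)[OF N] by linarith
qed

text \<open>For fixed velocity the upwind flux is odd in the density, so the lower bound applies to
  the negated density.\<close>

lemma density_upper_bound: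
  assumes ext: "\<And>\<sigma>. \<sigma> \<in> ext_faces \<Omega> M \<Longrightarrow> u \<sigma> = 0" and dt: "0 < dt"
    and mass: "\<And>K. K \<in> M \<Longrightarrow> (1 / dt) * (\<rho> K - \<rho>' K) +
             (1 / vol K) * (\<Sum>\<sigma>\<in>faces K. primal_flux \<Omega> M \<rho> u K \<sigma>) = 0"
    and dv: "\<And>K. K \<in> M \<Longrightarrow> discrete_div u K = 0"
    and up: "\<And>K. K \<in> M \<Longrightarrow> \<rho>' K \<le> m" and N: "N \<in> M"
  shows "\<rho> N \<le> m"
proof -
  have "primal_flux \<Omega> M (\<lambda>K. - \<rho> K) u K \<sigma> = - primal_flux \<Omega> M \<rho> u K \<sigma>" for K \<sigma>
    by (simp add: primal_flux_def upwind_density_def)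
  then have "(1 / dt) * (- \<rho> K - - \<rho>' K) +
      (1 / vol K) * (\<Sum>\<sigma>\<in>faces K. primal_flux \<Omega> M (\<lambda>K. - \<rho> K) u K \<sigma>) = 0" if "K \<in> M" for K
    using mass[OF that] by (simp add: sum_negf algebra_simps)
  from density_lower_bound[OF ext dt this dv, of "- m"] up N show ?thesis by simp
qed

section \<open>Quadratic density balance and the weak BV term\<close>

definition cell_pair :: "(real^'d) set \<Rightarrow> (real^'d) set \<times> (real^'d) set" where
  "cell_pair \<sigma> = (SOME (K, L). interface M \<sigma> K L)"

lemma cell_pair: "\<sigma> \<in> int_faces \<Omega> M \<Longrightarrow> interface M \<sigma> (fst (cell_pair \<sigma>)) (snd (cell_pair \<sigma>))"
  using interface_exists[of \<sigma>] someI_ex[of "\<lambda>(K, L). interface M \<sigma> K L"]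
  unfolding cell_pair_def case_prod_beta by simp

text \<open>The space part of \<open>weak_BV\<close> at one time level. As \<open>cell_pair\<close>
  repeats the choice made there, \<open>weak_BV_eq\<close> is a mere unfolding.\<close>

definition jump :: "'d scalars \<Rightarrow> 'd vectors \<Rightarrow> real" where
  "jump \<rho> u = (\<Sum>\<sigma>\<in>int_faces \<Omega> M. (let (K, L) = cell_pair \<sigma>
         in area \<sigma> * (\<rho> L - \<rho> K)\<^sup>2 * \<bar>u \<sigma> \<bullet> outer_normal K \<sigma>\<bar>))"

text \<open>The test factor is 2 \<rho>_K. The time difference is handled by 2 a (a - b) \<ge> a^2 -
  b^2, whose slack is the dissipation of the implicit step; the upwind dissipation is retained
  exactly as \<open>jump\<close>.\<close>

lemma density_L2_estimate:
  assumes ext: "\<And>\<sigma>. \<sigma> \<in> ext_faces \<Omega> M \<Longrightarrow> u \<sigma> = 0" and dt: "0 < dt"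
    and mass: "\<And>K. K \<in> M \<Longrightarrow> (1 / dt) * (\<rho> K - \<rho>' K) +
             (1 / vol K) * (\<Sum>\<sigma>\<in>faces K. primal_flux \<Omega> M \<rho> u K \<sigma>) = 0"
    and dv: "\<And>K. K \<in> M \<Longrightarrow> discrete_div u K = 0"
  shows "(\<Sum>K\<in>M. vol K * (\<rho> K)\<^sup>2) + dt * jump \<rho> u \<le> (\<Sum>K\<in>M. vol K * (\<rho>' K)\<^sup>2)"
proof -
  have "(\<Sum>K\<in>M. vol K * (\<rho> K)\<^sup>2) - (\<Sum>K\<in>M. vol K * (\<rho>' K)\<^sup>2) \<le>
      (\<Sum>K\<in>M. - dt * (\<Sum>\<sigma>\<in>faces K. 2 * \<rho> K * primal_flux \<Omega> M \<rho> u K \<sigma> - (\<rho> K)\<^sup>2 * face_flow u K \<sigma>))"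
    unfolding sum_subtractf[symmetric]
  proof (rule sum_mono)
    fix K assume K: "K \<in> M"
    have "vol K * (\<rho> K - \<rho>' K) = - dt * (\<Sum>\<sigma>\<in>faces K. primal_flux \<Omega> M \<rho> u K \<sigma>)"
      using mass[OF K] dt vol_pos[OF K] by (simp add: field_simps)
    \<comment> \<open>The term with \<open>(\<rho> K)\<^sup>2\<close> is zero by incompressibility
      and completes the square. If upwinding is from K with outflow f, the two sides of the face add
      up to f (2 \<rho>_K^2 - \<rho>_K^2 - 2 \<rho>_K \<rho>_L + \<rho>_L^2).\<close>
    then have "2 * \<rho> K * (vol K * (\<rho> K - \<rho>' K)) =
        - dt * (2 * \<rho> K * (\<Sum>\<sigma>\<in>faces K. primal_flux \<Omega> M \<rho> u K \<sigma>) - (\<rho> K)\<^sup>2 * (\<Sum>\<sigma>\<in>faces K. face_flow u K \<sigma>))"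
      using sum_face_flow[OF dv[OF K] K] by simp
    moreover have "vol K * (\<rho> K)\<^sup>2 - vol K * (\<rho>' K)\<^sup>2 \<le> 2 * \<rho> K * (vol K * (\<rho> K - \<rho>' K))"
    proof -
      have "0 \<le> vol K * (\<rho> K - \<rho>' K)\<^sup>2" using vol_pos[OF K] by simp
      then show ?thesis by (simp add: power2_eq_square algebra_simps)
    qed
    ultimately show "vol K * (\<rho> K)\<^sup>2 - vol K * (\<rho>' K)\<^sup>2 \<le>
        - dt * (\<Sum>\<sigma>\<in>faces K. 2 * \<rho> K * primal_flux \<Omega> M \<rho> u K \<sigma> - (\<rho> K)\<^sup>2 * face_flow u K \<sigma>)"
      by (simp add: sum_subtractf sum_distrib_left)
  qed
  also have "\<dots> = - dt * (\<Sum>\<sigma>\<in>int_faces \<Omega> M. \<Sum>K\<in>face_cells M \<sigma>.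
      2 * \<rho> K * primal_flux \<Omega> M \<rho> u K \<sigma> - (\<rho> K)\<^sup>2 * face_flow u K \<sigma>)"
    unfolding sum_distrib_left[symmetric]
    by (subst sum_cells_int_faces) (auto simp: ext primal_flux_def face_flow_def)
  also have "(\<Sum>\<sigma>\<in>int_faces \<Omega> M. \<Sum>K\<in>face_cells M \<sigma>.
      2 * \<rho> K * primal_flux \<Omega> M \<rho> u K \<sigma> - (\<rho> K)\<^sup>2 * face_flow u K \<sigma>) = jump \<rho> u"
    unfolding jump_def
  proof (rule sum.cong[OF refl])
    fix \<sigma> assume \<sigma>: "\<sigma> \<in> int_faces \<Omega> M"
    obtain K L where KL: "cell_pair \<sigma> = (K, L)" by fastforce
    then have I: "interface M \<sigma> K L" using cell_pair[OF \<sigma>] by simp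
    define s where "s = u \<sigma> \<bullet> outer_normal K \<sigma>"
    have flux: "primal_flux \<Omega> M \<rho> u K \<sigma> = (if 0 \<le> s then \<rho> K else \<rho> L) * face_flow u K \<sigma>"
      "primal_flux \<Omega> M \<rho> u L \<sigma> = - (if 0 \<le> s then \<rho> K else \<rho> L) * face_flow u K \<sigma>"
      unfolding s_def using upwind_density_interface[OF I] primal_flux_eq[of u, OF ext] by metis+
    show "(\<Sum>K\<in>face_cells M \<sigma>. 2 * \<rho> K * primal_flux \<Omega> M \<rho> u K \<sigma> - (\<rho> K)\<^sup>2 * face_flow u K \<sigma>) =
        (let (K, L) = cell_pair \<sigma> in area \<sigma> * (\<rho> L - \<rho> K)\<^sup>2 * \<bar>u \<sigma> \<bullet> outer_normal K \<sigma>\<bar>)"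
      unfolding sum_face_cells_interface[OF I] flux face_flow_interface[OF I] KL Let_def prod.case
      unfolding face_flow_def s_def[symmetric]
      by (cases "0 \<le> s") (auto simp: power2_eq_square algebra_simps)
  qed
  finally show ?thesis by simp
qed

section \<open>Kinetic energy balance\<close>

definition cell_energy :: "'d scalars \<Rightarrow> 'd vectors \<Rightarrow> real" where
  "cell_energy \<rho> u = (\<Sum>K\<in>M. \<Sum>\<sigma>\<in>faces K. vol (D K \<sigma>) * \<rho> K * (norm (u \<sigma>))\<^sup>2)"

definition dual_mass :: "'d scalars \<Rightarrow> (real^'d) set \<Rightarrow> real" where
  "dual_mass \<rho> \<sigma> = (\<Sum>K\<in>face_cells M \<sigma>. vol (D K \<sigma>) * \<rho> K)"

text \<open>Twice the kinetic energy needs both groupings: by cells, so that cellwise density bounds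
  act term by term, and by faces, where the momentum balance is tested.\<close>

lemma cell_energy_dual:
  assumes "\<And>\<sigma>. \<sigma> \<in> ext_faces \<Omega> M \<Longrightarrow> u \<sigma> = 0"
  shows "cell_energy \<rho> u = (\<Sum>\<sigma>\<in>int_faces \<Omega> M. dual_mass \<rho> \<sigma> * (norm (u \<sigma>))\<^sup>2)"
  unfolding cell_energy_def dual_mass_def sum_distrib_right
  by (rule sum_cells_int_faces) (simp add: assms)

text \<open>Adjacency is symmetric, so exchanging the two summations maps the sum to its
  negative.\<close>

lemma sum_antisymmetric_adjacent:
  fixes h :: "(real^'d) set \<Rightarrow> (real^'d) set \<Rightarrow> real"
  assumes K: "K \<in> M"
    and anti: "\<And>\<sigma> \<sigma>'. \<sigma> \<in> faces K \<Longrightarrow> \<sigma>' \<in> adjacent_faces K \<sigma> \<Longrightarrow> h \<sigma> \<sigma>' = - h \<sigma>' \<sigma>"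
  shows "(\<Sum>\<sigma>\<in>faces K. \<Sum>\<sigma>'\<in>adjacent_faces K \<sigma>. h \<sigma> \<sigma>') = 0"
proof -
  let ?A = "\<lambda>\<sigma> \<sigma>'. \<sigma>' \<noteq> \<sigma> \<and> \<sigma>' \<inter> \<sigma> \<noteq> {}"
  have A: "adjacent_faces K \<sigma> = {\<sigma>'\<in>faces K. ?A \<sigma> \<sigma>'}" for \<sigma> by (simp add: adjacent_faces_def)
  have "(\<Sum>\<sigma>\<in>faces K. \<Sum>\<sigma>'\<in>adjacent_faces K \<sigma>. h \<sigma> \<sigma>') =
      (\<Sum>\<sigma>'\<in>faces K. \<Sum>\<sigma>\<in>{\<sigma>\<in>faces K. ?A \<sigma> \<sigma>'}. h \<sigma> \<sigma>')"
    unfolding A by (rule sum.swap_restrict) (use finite_faces[OF K] in auto)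
  also have "\<dots> = (\<Sum>\<sigma>'\<in>faces K. \<Sum>\<sigma>\<in>adjacent_faces K \<sigma>'. - h \<sigma>' \<sigma>)"
  proof (intro sum.cong refl)
    show "{\<sigma>\<in>faces K. ?A \<sigma> \<sigma>'} = adjacent_faces K \<sigma>'" for \<sigma>' by (auto simp: adjacent_faces_def)
    show "h \<sigma> \<sigma>' = - h \<sigma>' \<sigma>" if "\<sigma>' \<in> faces K" "\<sigma> \<in> adjacent_faces K \<sigma>'" for \<sigma> \<sigma>'
      using anti[OF that] by simp
  qed
  also have "\<dots> = - (\<Sum>\<sigma>\<in>faces K. \<Sum>\<sigma>'\<in>adjacent_faces K \<sigma>. h \<sigma> \<sigma>')" by (simp add: sum_negf)
  finally show ?thesis by simp
qed

(* The primal fluxes through the two sides of an internal face cancel, which turns (H1) into a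
   discrete mass balance on the dual cells. *)
lemma dual_mass_balance:
  assumes ext: "\<And>\<sigma>. \<sigma> \<in> ext_faces \<Omega> M \<Longrightarrow> u \<sigma> = 0" and dt: "0 < dt"
    and mass: "\<And>K. K \<in> M \<Longrightarrow> (1 / dt) * (\<rho> K - \<rho>' K) +
             (1 / vol K) * (\<Sum>\<sigma>\<in>faces K. primal_flux \<Omega> M \<rho> u K \<sigma>) = 0"
    and dual: "dual_flux_conditions M A C (primal_flux \<Omega> M \<rho> u)"
    and \<sigma>: "\<sigma> \<in> int_faces \<Omega> M"
  shows "dual_mass \<rho> \<sigma> - dual_mass \<rho>' \<sigma> =
    - dt * (\<Sum>K\<in>face_cells M \<sigma>. \<Sum>\<sigma>'\<in>adjacent_faces K \<sigma>. dual_flux A (primal_flux \<Omega> M \<rho> u) K \<sigma> \<sigma>')"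
proof -
  let ?F = "primal_flux \<Omega> M \<rho> u"
  obtain K L where I: "interface M \<sigma> K L" using interface_exists[OF \<sigma>] by blast
  \<comment> \<open>The weight 1/(2d) in (H1) is the volume fraction of the subvolume
    \<open>D N \<sigma>\<close> in \<open>N\<close>. The primal balance scaled by it is therefore
    the balance on one side of the dual cell.\<close>
  have N: "vol (D N \<sigma>) * \<rho> N - vol (D N \<sigma>) * \<rho>' N =
      - dt * (?F N \<sigma> + (\<Sum>\<sigma>'\<in>adjacent_faces N \<sigma>. dual_flux A ?F N \<sigma> \<sigma>'))"
    if "N \<in> M" "\<sigma> \<in> faces N" for N
  proof -
    have "vol N * (\<rho> N - \<rho>' N) = - dt * (\<Sum>\<sigma>\<in>faces N. ?F N \<sigma>)"
      using mass[OF that(1)] dt vol_pos[OF that(1)] by (simp add: field_simps)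
    moreover have "?F N \<sigma> + (\<Sum>\<sigma>'\<in>adjacent_faces N \<sigma>. dual_flux A ?F N \<sigma> \<sigma>') =
          1 / (2 * real CARD('d)) * (\<Sum>\<tau>\<in>faces N. ?F N \<tau>)"
      using dual that unfolding dual_flux_conditions_def by blast
    moreover have "vol (D N \<sigma>) * \<rho> N - vol (D N \<sigma>) * \<rho>' N = 1 / (2 * real CARD('d)) * (vol N * (\<rho> N - \<rho>' N))"
      by (simp add: vol_subvol[OF that] right_diff_distrib diff_divide_distrib)
    ultimately show ?thesis by simp
  qed
  have "primal_flux \<Omega> M \<rho> u L \<sigma> = - primal_flux \<Omega> M \<rho> u K \<sigma>"
    by (rule primal_flux_interface[OF ext I])
  moreover have "K \<in> M" "L \<in> M" "\<sigma> \<in> faces K" "\<sigma> \<in> faces L" using I by (auto simp: interface_def)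
  ultimately show ?thesis
    unfolding dual_mass_def sum_face_cells_interface[OF I] using N[of K] N[of L]
    by (simp add: algebra_simps)
qed

text \<open>The algebraic core is (2 m u - 2 m' u').u - (m - m') |u|^2 = m |u|^2 - m' |u'|^2 + m' |u
  - u'|^2. Subtracting the mass balance times |u|^2 is legitimate because the dual mass and the
  momentum are carried by the same dual fluxes.\<close>

lemma kinetic_energy_estimate:
  assumes ext: "\<And>\<sigma>. \<sigma> \<in> ext_faces \<Omega> M \<Longrightarrow> u \<sigma> = 0" "\<And>\<sigma>. \<sigma> \<in> ext_faces \<Omega> M \<Longrightarrow> u' \<sigma> = 0"
    and dt: "0 < dt" and shapes: "rt_shape_functions M \<zeta>"
    and step: "scheme_step \<Omega> M D \<zeta> A dt \<rho>' u' \<rho> u p"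
    and dual: "dual_flux_conditions M A C (primal_flux \<Omega> M \<rho> u)"
    and pos: "\<And>K. K \<in> M \<Longrightarrow> 0 \<le> \<rho>' K"
  shows "cell_energy \<rho> u + 2 * dt * (broken_norm M \<zeta> u)\<^sup>2 \<le> cell_energy \<rho>' u'"
proof -
  let ?F = "primal_flux \<Omega> M \<rho> u"
  let ?I = "int_faces \<Omega> M"
  let ?\<phi> = "dual_flux A ?F"
  have mass: "\<And>K. K \<in> M \<Longrightarrow> (1 / dt) * (\<rho> K - \<rho>' K) + (1 / vol K) * (\<Sum>\<sigma>\<in>faces K. ?F K \<sigma>) = 0"
    and dv: "\<And>K. K \<in> M \<Longrightarrow> discrete_div u K = 0"
    using step by (simp_all add: scheme_step_def)
  define m where "m = dual_mass \<rho>"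
  define m' where "m' = dual_mass \<rho>'"
  define \<Phi> where "\<Phi> = (\<lambda>\<sigma>. \<Sum>K\<in>face_cells M \<sigma>. \<Sum>\<sigma>'\<in>adjacent_faces K \<sigma>. ?\<phi> K \<sigma> \<sigma>')"
  define c where "c = (\<lambda>\<sigma>. \<Sum>K\<in>face_cells M \<sigma>. \<Sum>\<sigma>'\<in>adjacent_faces K \<sigma>. ?\<phi> K \<sigma> \<sigma>' * (u \<sigma> \<bullet> u \<sigma>'))"
  define l where "l = (\<lambda>\<sigma>. \<Sum>K\<in>M. u \<sigma> \<bullet>
    (\<Sum>\<sigma>'\<in>faces K. (LINT x:K|lebesgue. grad (\<zeta> K \<sigma>') x \<bullet> grad (\<zeta> K \<sigma>) x) *\<^sub>R u \<sigma>'))"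
  define q where "q = (\<lambda>\<sigma>. \<Sum>K\<in>face_cells M \<sigma>. - p K * face_flow u K \<sigma>)"
  \<comment> \<open>The test vector is 2 dt |D_\<sigma>| u_\<sigma>. Since the convected value is
    the mean over the two dual cells, convection splits into \<open>\<Phi> \<sigma>\<close> times
    |u_\<sigma>|^2, to be traded for the change of mass, and the cross term
    \<open>c \<sigma>\<close>, which is antisymmetric in the two faces.\<close>
  have momentum: "2 * (m \<sigma> * (u \<sigma> \<bullet> u \<sigma>) - m' \<sigma> * (u' \<sigma> \<bullet> u \<sigma>)) +
      dt * (\<Phi> \<sigma> * (u \<sigma> \<bullet> u \<sigma>) + c \<sigma>) + 2 * dt * l \<sigma> + 2 * dt * q \<sigma> = 0" if \<sigma>: "\<sigma> \<in> ?I" for \<sigma>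
  proof -
    obtain K L where I: "interface M \<sigma> K L" using interface_exists[OF \<sigma>] by blast
    define V where "V = vol (dual_cell M D \<sigma>)"
    have V: "V > 0" using vol_dual_cell_pos[of \<sigma>] \<sigma> by (simp add: V_def int_faces_def)
    have "(1 / dt) *\<^sub>R (dual_density M D \<rho> \<sigma> *\<^sub>R u \<sigma> - dual_density M D \<rho>' \<sigma> *\<^sub>R u' \<sigma>) +
        convection M D A ?F u \<sigma> + neg_laplacian M D \<zeta> u \<sigma> + pressure_gradient M D p \<sigma> K L = 0"
      using step \<sigma> I unfolding scheme_step_def by blast
    then have "u \<sigma> \<bullet> ((2 * dt * V) *\<^sub>R ((1 / dt) *\<^sub>R (dual_density M D \<rho> \<sigma> *\<^sub>R u \<sigma> - dual_density M D \<rho>' \<sigma> *\<^sub>R u' \<sigma>) +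
        convection M D A ?F u \<sigma> + neg_laplacian M D \<zeta> u \<sigma> + pressure_gradient M D p \<sigma> K L)) = 0"
      by simp
    then have eq: "2 * (V * dual_density M D \<rho> \<sigma> * (u \<sigma> \<bullet> u \<sigma>) - V * dual_density M D \<rho>' \<sigma> * (u' \<sigma> \<bullet> u \<sigma>)) +
        dt * (2 * V * (u \<sigma> \<bullet> convection M D A ?F u \<sigma>)) + 2 * dt * (V * (u \<sigma> \<bullet> neg_laplacian M D \<zeta> u \<sigma>)) +
        2 * dt * (V * (u \<sigma> \<bullet> pressure_gradient M D p \<sigma> K L)) = 0"
      using dt by (simp add: inner_add_right inner_diff_right algebra_simps inner_commute)
    have d: "V * dual_density M D r \<sigma> = dual_mass r \<sigma>" for r
      using V by (simp add: dual_density_def dual_mass_def V_def)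
    have "2 * V * (u \<sigma> \<bullet> convection M D A ?F u \<sigma>) =
        2 * (\<Sum>K\<in>face_cells M \<sigma>. \<Sum>\<sigma>'\<in>adjacent_faces K \<sigma>. ?\<phi> K \<sigma> \<sigma>' * ((u \<sigma> \<bullet> u \<sigma> + u \<sigma> \<bullet> u \<sigma>') / 2))"
      using V by (simp add: convection_def V_def inner_sum_right inner_add_right)
    also have "\<dots> = \<Phi> \<sigma> * (u \<sigma> \<bullet> u \<sigma>) + c \<sigma>"
      unfolding \<Phi>_def c_def sum_distrib_left sum_distrib_right sum.distrib[symmetric]
      by (intro sum.cong refl) (simp add: field_simps)
    finally have cv: "2 * V * (u \<sigma> \<bullet> convection M D A ?F u \<sigma>) = \<Phi> \<sigma> * (u \<sigma> \<bullet> u \<sigma>) + c \<sigma>" .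
    have lp: "V * (u \<sigma> \<bullet> neg_laplacian M D \<zeta> u \<sigma>) = l \<sigma>"
      using V by (simp add: neg_laplacian_def V_def l_def inner_sum_right)
    have pr: "V * (u \<sigma> \<bullet> pressure_gradient M D p \<sigma> K L) = q \<sigma>"
      unfolding q_def sum_face_cells_interface[OF I] face_flow_interface[OF I]
      using V by (simp add: pressure_gradient_def V_def[symmetric] face_flow_def left_diff_distrib right_diff_distrib)
    show ?thesis using eq unfolding d cv lp pr m_def m'_def .
  qed
  have face: "m \<sigma> * (u \<sigma> \<bullet> u \<sigma>) - m' \<sigma> * (u' \<sigma> \<bullet> u' \<sigma>) + dt * c \<sigma> + 2 * dt * l \<sigma> + 2 * dt * q \<sigma> \<le> 0"
    if \<sigma>: "\<sigma> \<in> ?I" for \<sigma>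
  proof -
    have "m \<sigma> - m' \<sigma> = - dt * \<Phi> \<sigma>"
      unfolding m_def m'_def \<Phi>_def by (rule dual_mass_balance[OF ext(1) dt mass dual \<sigma>])
    then have "dt * \<Phi> \<sigma> * (u \<sigma> \<bullet> u \<sigma>) = - (m \<sigma> - m' \<sigma>) * (u \<sigma> \<bullet> u \<sigma>)" by simp
    moreover have "0 \<le> m' \<sigma>"
      unfolding m'_def dual_mass_def
      by (intro sum_nonneg mult_nonneg_nonneg) (auto simp: face_cells_def pos vol_def)
    \<comment> \<open>The numerical dissipation of the implicit time step, discarded below;
      nonnegativity of the old density gives its sign.\<close>
    then have "0 \<le> m' \<sigma> * ((u \<sigma> - u' \<sigma>) \<bullet> (u \<sigma> - u' \<sigma>))" by simp
    ultimately show ?thesis using momentum[OF \<sigma>]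
      by (simp add: inner_diff_left inner_diff_right algebra_simps inner_commute)
  qed
  have "(\<Sum>\<sigma>\<in>?I. c \<sigma>) = (\<Sum>K\<in>M. \<Sum>\<sigma>\<in>faces K. \<Sum>\<sigma>'\<in>adjacent_faces K \<sigma>. ?\<phi> K \<sigma> \<sigma>' * (u \<sigma> \<bullet> u \<sigma>'))"
    unfolding c_def by (rule sum_cells_int_faces[symmetric]) (simp add: ext)
  also have "\<dots> = 0"
  proof (rule sum.neutral, rule ballI, rule sum_antisymmetric_adjacent)
    fix K \<sigma> \<sigma>' assume "K \<in> M" and "\<sigma> \<in> faces K" "\<sigma>' \<in> adjacent_faces K \<sigma>"
    then have "?\<phi> K \<sigma> \<sigma>' = - ?\<phi> K \<sigma>' \<sigma>" using dual unfolding dual_flux_conditions_def by blast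
    then show "?\<phi> K \<sigma> \<sigma>' * (u \<sigma> \<bullet> u \<sigma>') = - (?\<phi> K \<sigma>' \<sigma> * (u \<sigma>' \<bullet> u \<sigma>))" by (simp add: inner_commute)
  qed
  finally have c0: "(\<Sum>\<sigma>\<in>?I. c \<sigma>) = 0" .
  have "(\<Sum>\<sigma>\<in>?I. q \<sigma>) = (\<Sum>K\<in>M. \<Sum>\<sigma>\<in>faces K. - p K * face_flow u K \<sigma>)"
    unfolding q_def by (rule sum_cells_int_faces[symmetric]) (simp add: ext face_flow_def)
  also have "\<dots> = (\<Sum>K\<in>M. - p K * (\<Sum>\<sigma>\<in>faces K. face_flow u K \<sigma>))"
    by (simp only: sum_distrib_left)
  also have "\<dots> = 0" by (rule sum.neutral) (simp add: sum_face_flow dv)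
  finally have q0: "(\<Sum>\<sigma>\<in>?I. q \<sigma>) = 0" .
  \<comment> \<open>The tested diffusion vanishes on external faces, where \<open>u\<close> is 0, so
    the sum can be extended to all faces, as in the broken norm.\<close>
  have "(\<Sum>\<sigma>\<in>?I. l \<sigma>) = (\<Sum>\<sigma>\<in>mesh_faces M. l \<sigma>)"
    by (rule sum.mono_neutral_left[OF finite_mesh_faces]) (auto simp: int_faces_def l_def ext)
  also have "\<dots> = (broken_norm M \<zeta> u)\<^sup>2"
    unfolding l_def
    by (subst sum.swap, rule broken_norm_sq[symmetric, OF shapes finite_cells cell])
  finally have l1: "(\<Sum>\<sigma>\<in>?I. l \<sigma>) = (broken_norm M \<zeta> u)\<^sup>2" .
  have "(\<Sum>\<sigma>\<in>?I. m \<sigma> * (u \<sigma> \<bullet> u \<sigma>) - m' \<sigma> * (u' \<sigma> \<bullet> u' \<sigma>) + dt * c \<sigma> + 2 * dt * l \<sigma> + 2 * dt * q \<sigma>) \<le> 0"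
    by (rule sum_nonpos) (rule face)
  then have "(\<Sum>\<sigma>\<in>?I. m \<sigma> * (u \<sigma> \<bullet> u \<sigma>)) - (\<Sum>\<sigma>\<in>?I. m' \<sigma> * (u' \<sigma> \<bullet> u' \<sigma>)) +
      dt * (\<Sum>\<sigma>\<in>?I. c \<sigma>) + 2 * dt * (\<Sum>\<sigma>\<in>?I. l \<sigma>) + 2 * dt * (\<Sum>\<sigma>\<in>?I. q \<sigma>) \<le> 0"
    by (simp only: sum.distrib sum_subtractf sum_distrib_left)
  moreover have "cell_energy \<rho> u = (\<Sum>\<sigma>\<in>?I. m \<sigma> * (u \<sigma> \<bullet> u \<sigma>))"
    unfolding m_def power2_norm_eq_inner[symmetric] by (rule cell_energy_dual) (rule ext)
  moreover have "cell_energy \<rho>' u' = (\<Sum>\<sigma>\<in>?I. m' \<sigma> * (u' \<sigma> \<bullet> u' \<sigma>))"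
    unfolding m'_def power2_norm_eq_inner[symmetric] by (rule cell_energy_dual) (rule ext)
  ultimately show ?thesis unfolding c0 q0 l1 by linarith
qed

section \<open>Discrete functions and initial data\<close>

text \<open>The covering only places \<open>K\<close> in the closure of \<Omega>, and an open set
  can miss part of the interior of its closure, like a slit domain. Being the interior of a finite
  union of polytopes excludes this.\<close>

lemma cell_subset_domain: assumes "K \<in> M" shows "K \<subseteq> \<Omega>"
proof -
  obtain P where P: "finite P" "\<And>C. C \<in> P \<Longrightarrow> polytope C" "\<Omega> = interior (\<Union>P)"
    using domain by (auto simp: polyhedral_domain_def)
  have "closed (\<Union>P)" using P(1,2) by (intro closed_Union) (auto simp: polytope_imp_closed)
  then have "closure \<Omega> \<subseteq> \<Union>P" unfolding P(3) by (rule closure_minimal[OF interior_subset])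
  then have "K \<subseteq> \<Union>P" using closure_domain assms closure_subset by blast
  then show ?thesis unfolding P(3) using mesh_cellD(1)[OF cell[OF assms]] by (rule interior_maximal)
qed

lemma domain_lmeasurable: "\<Omega> \<in> lmeasurable"
  using domain by (simp add: polyhedral_domain_def lmeasurable_open)

lemma cell_lmeasurable: "K \<in> M \<Longrightarrow> K \<in> lmeasurable"
  using mesh_cellD(7) cell by blast

lemma negligible_closure_cells: "F \<subseteq> M \<Longrightarrow> negligible ((\<Union>K\<in>F. closure K) - \<Union>F)"
proof -
  assume F: "F \<subseteq> M"
  have "negligible (\<Union>K\<in>F. closure K - K)"
  proof (rule negligible_Union)
    show "finite ((\<lambda>K. closure K - K) ` F)" using F finite_cells finite_subset by blast
  qed (use F cell mesh_cellD(9) in blast)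
  then show ?thesis by (rule negligible_subset) auto
qed

lemma AE_in_cell: "AE x in lebesgue_on \<Omega>. \<exists>K\<in>M. x \<in> K"
proof -
  have "negligible (\<Omega> - \<Union>M)"
    using negligible_closure_cells[OF order_refl] closure_domain closure_subset[of \<Omega>]
    by (auto intro: negligible_subset)
  then have "AE x in lebesgue. x \<notin> \<Omega> - \<Union>M"
    by (intro AE_not_in) (simp add: negligible_iff_null_sets)
  then have "AE x in lebesgue. x \<in> \<Omega> \<longrightarrow> (\<exists>K\<in>M. x \<in> K)" by eventually_elim auto
  then show ?thesis using domain_lmeasurable by (simp add: AE_restrict_space_iff fmeasurableD)
qed

lemma cell_unique: "K \<in> M \<Longrightarrow> L \<in> M \<Longrightarrow> x \<in> K \<Longrightarrow> x \<in> L \<Longrightarrow> K = L"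
  using cells_disjnt by (meson disjnt_iff)

lemma sum_indicator_cells:
  assumes "K \<in> M" "x \<in> K" shows "(\<Sum>L\<in>M. indicat_real L x * h L) = h K"
proof -
  have "(\<Sum>L\<in>M. indicat_real L x * h L) = (\<Sum>L\<in>{K}. indicat_real L x * h L)"
    by (rule sum.mono_neutral_right[OF finite_cells]) (use assms cell_unique in \<open>auto simp: indicator_def\<close>)
  then show ?thesis using assms by simp
qed

section \<open>Integrals over cells and the initial data\<close>

lemma set_integrable_cell:
  fixes g :: "real^'d \<Rightarrow> 'b::{banach, second_countable_topology}"
  assumes "integrable (lebesgue_on \<Omega>) g" "K \<in> M"
  shows "set_integrable lebesgue K g"
proof -
  have "set_integrable lebesgue \<Omega> g"
    using assms domain_lmeasurable by (simp add: integrable_restrict_space set_integrable_def fmeasurableD)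
  then show ?thesis
    by (rule set_integrable_subset) (use assms cell_lmeasurable cell_subset_domain in \<open>auto simp: fmeasurableD\<close>)
qed

lemma sum_integral_cells_le:
  fixes g :: "real^'d \<Rightarrow> real"
  assumes g: "integrable (lebesgue_on \<Omega>) g" "\<And>x. 0 \<le> g x"
  shows "(\<Sum>K\<in>M. LINT x:K|lebesgue. g x) \<le> integral\<^sup>L (lebesgue_on \<Omega>) g"
proof -
  have i: "integrable lebesgue (\<lambda>x. indicat_real \<Omega> x *\<^sub>R g x)"
    using g domain_lmeasurable by (simp add: integrable_restrict_space fmeasurableD)
  have iK: "integrable lebesgue (\<lambda>x. indicat_real K x *\<^sub>R g x)" if "K \<in> M" for K
    using set_integrable_cell[OF g(1) that] by (simp add: set_integrable_def)
  have "(\<Sum>K\<in>M. LINT x:K|lebesgue. g x) = (LINT x|lebesgue. (\<Sum>K\<in>M. indicat_real K x *\<^sub>R g x))"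
    unfolding set_lebesgue_integral_def
    by (rule Bochner_Integration.integral_sum[symmetric]) (rule iK)
  also have "\<dots> \<le> (LINT x|lebesgue. indicat_real \<Omega> x *\<^sub>R g x)"
  proof (rule integral_mono[OF Bochner_Integration.integrable_sum[OF iK] i])
    fix x
    show "(\<Sum>K\<in>M. indicat_real K x *\<^sub>R g x) \<le> indicat_real \<Omega> x *\<^sub>R g x"
    proof (cases "\<exists>K\<in>M. x \<in> K")
      case True
      then obtain K where "K \<in> M" "x \<in> K" by blast
      moreover from this have "x \<in> \<Omega>" using cell_subset_domain by blast
      ultimately show ?thesis using sum_indicator_cells[of K x "\<lambda>_. g x"] by simp
    next
      case False
      then have "(\<Sum>K\<in>M. indicat_real K x *\<^sub>R g x) = 0" by (intro sum.neutral) auto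
      then show ?thesis using g(2) by simp
    qed
  qed
  also have "\<dots> = integral\<^sup>L (lebesgue_on \<Omega>) g"
    using domain_lmeasurable by (simp add: integral_restrict_space fmeasurableD)
  finally show ?thesis .
qed

lemma sum_vol_cells_le: "(\<Sum>K\<in>M. vol K) \<le> vol \<Omega>"
proof -
  have "finite_measure (lebesgue_on \<Omega>)"
    using domain_lmeasurable by (rule finite_measure_lebesgue_on)
  then have "integrable (lebesgue_on \<Omega>) (\<lambda>x. 1 :: real)" by (rule finite_measure.integrable_const)
  from sum_integral_cells_le[OF this] show ?thesis
    using domain_lmeasurable cell_lmeasurable
    by (simp add: set_lebesgue_integral_def vol_def measure_restrict_space fmeasurableD)
qed

lemma cell_average_bounds:
  assumes meas: "\<rho>0 \<in> borel_measurable (lebesgue_on \<Omega>)"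
    and lo: "AE x in lebesgue_on \<Omega>. a \<le> \<rho>0 x" and up: "AE x in lebesgue_on \<Omega>. \<rho>0 x \<le> b" and K: "K \<in> M"
  shows "a \<le> (1 / vol K) * (LINT x:K|lebesgue. \<rho>0 x)" "(1 / vol K) * (LINT x:K|lebesgue. \<rho>0 x) \<le> b"
proof -
  interpret \<Omega>: finite_measure "lebesgue_on \<Omega>"
    using domain_lmeasurable by (rule finite_measure_lebesgue_on)
  have "integrable (lebesgue_on \<Omega>) \<rho>0"
    by (rule \<Omega>.integrable_const_bound[where B="max \<bar>a\<bar> \<bar>b\<bar>"])
       (use lo up meas in \<open>auto elim!: eventually_elim2\<close>)
  then have i: "set_integrable lebesgue K \<rho>0" using K by (rule set_integrable_cell)
  have AE: "AE x in lebesgue. x \<in> K \<longrightarrow> P x" if "AE x in lebesgue_on \<Omega>. P x" for P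
  proof -
    have "AE x in lebesgue. x \<in> \<Omega> \<longrightarrow> P x"
      using that domain_lmeasurable by (simp add: AE_restrict_space_iff fmeasurableD)
    then show ?thesis by eventually_elim (use cell_subset_domain[OF K] in blast)
  qed
  have c: "set_integrable lebesgue K (\<lambda>x. e)" "(LINT x:K|lebesgue. e) = vol K * e" for e :: real
    using cell_lmeasurable[OF K] unfolding set_integrable_def
    by (auto simp: set_lebesgue_integral_def vol_def lmeasurable_iff_integrable intro!: integrable_scaleR_left)
  have "vol K * a \<le> (LINT x:K|lebesgue. \<rho>0 x)"
    unfolding c(2)[symmetric] by (rule set_integral_mono_AE[OF c(1) i AE[OF lo]])
  moreover have "(LINT x:K|lebesgue. \<rho>0 x) \<le> vol K * b"
    unfolding c(2)[symmetric] by (rule set_integral_mono_AE[OF i c(1) AE[OF up]])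
  ultimately show "a \<le> (1 / vol K) * (LINT x:K|lebesgue. \<rho>0 x)" "(1 / vol K) * (LINT x:K|lebesgue. \<rho>0 x) \<le> b"
    using vol_pos[OF K] by (simp_all add: field_simps)
qed

text \<open>The constant 4d is 2 times 2d: a factor 2 from the two sides of an internal face in
  \<open>dual_mass\<close>, and 2d from the faces among which each cell integral recurs. The average
  over a dual cell is bounded by integrals over its two whole neighbouring cells.\<close>

lemma cell_energy_initial:
  assumes u0: "integrable (lebesgue_on \<Omega>) (\<lambda>x. (norm (u0 x))\<^sup>2)"
    and init: "\<And>\<sigma>. \<sigma> \<in> int_faces \<Omega> M \<Longrightarrow>
      u \<sigma> = (1 / vol (dual_cell M D \<sigma>)) *\<^sub>R (LINT x:dual_cell M D \<sigma>|lebesgue. u0 x)"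
    and ext: "\<And>\<sigma>. \<sigma> \<in> ext_faces \<Omega> M \<Longrightarrow> u \<sigma> = 0"
    and up: "\<And>K. K \<in> M \<Longrightarrow> \<rho> K \<le> r" and r: "0 \<le> r"
  shows "cell_energy \<rho> u \<le> 4 * real CARD('d) * r * (\<integral>x. (norm (u0 x))\<^sup>2 \<partial>lebesgue_on \<Omega>)"
proof -
  let ?J = "\<lambda>K. LINT x:K|lebesgue. (norm (u0 x))\<^sup>2"
  have J: "0 \<le> ?J K" for K
    unfolding set_lebesgue_integral_def by (intro Bochner_Integration.integral_nonneg) simp
  have face: "dual_mass \<rho> \<sigma> * (norm (u \<sigma>))\<^sup>2 \<le> 2 * r * (\<Sum>K\<in>face_cells M \<sigma>. ?J K)" if \<sigma>: "\<sigma> \<in> int_faces \<Omega> M" for \<sigma>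
  proof -
    let ?V = "vol (dual_cell M D \<sigma>)"
    obtain K L where I: "interface M \<sigma> K L" using interface_exists[OF \<sigma>] by blast
    have V: "0 < ?V" using vol_dual_cell_pos[of \<sigma>] \<sigma> by (simp add: int_faces_def)
    have N: "vol (D N \<sigma>) * \<rho> N \<le> ?V * r" if "N \<in> M" "\<sigma> \<in> faces N" for N
    proof -
      have "vol (D N \<sigma>) * \<rho> N \<le> vol (D N \<sigma>) * r"
        by (rule mult_left_mono[OF up[OF that(1)]]) (simp add: vol_def)
      also have "\<dots> \<le> ?V * r" by (rule mult_right_mono[OF vol_subvol_le_dual_cell[OF that] r])
      finally show ?thesis .
    qed
    have "dual_mass \<rho> \<sigma> \<le> 2 * r * ?V"
      unfolding dual_mass_def sum_face_cells_interface[OF I]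
      using I N[of K] N[of L] by (simp add: interface_def mult.assoc mult.commute[of r])
    then have "dual_mass \<rho> \<sigma> * (norm (u \<sigma>))\<^sup>2 \<le> 2 * r * ?V * (norm (u \<sigma>))\<^sup>2"
      by (rule mult_right_mono) simp
    moreover have "?V * (norm (u \<sigma>))\<^sup>2 \<le> (\<Sum>K\<in>face_cells M \<sigma>. ?J K)"
      unfolding init[OF \<sigma>]
    proof (rule average_sq_le[OF lmeasurable_dual_cell V finite_face_cells])
      show "set_integrable lebesgue K (\<lambda>x. (norm (u0 x))\<^sup>2)" if "K \<in> face_cells M \<sigma>" for K
        using set_integrable_cell[OF u0] that by (simp add: face_cells_def)
      have "negligible ((\<Union>K\<in>face_cells M \<sigma>. closure K) - \<Union>(face_cells M \<sigma>))"
        by (rule negligible_closure_cells) (auto simp: face_cells_def)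
      then show "negligible (dual_cell M D \<sigma> - \<Union>(face_cells M \<sigma>))"
        by (rule negligible_subset) (use subvol_subset in \<open>fastforce simp: dual_cell_def face_cells_def\<close>)
    qed
    then have "2 * r * (?V * (norm (u \<sigma>))\<^sup>2) \<le> 2 * r * (\<Sum>K\<in>face_cells M \<sigma>. ?J K)"
      by (rule mult_left_mono) (use r in simp)
    ultimately show ?thesis by (simp add: mult.assoc)
  qed
  have "cell_energy \<rho> u = (\<Sum>\<sigma>\<in>int_faces \<Omega> M. dual_mass \<rho> \<sigma> * (norm (u \<sigma>))\<^sup>2)"
    by (rule cell_energy_dual) (rule ext)
  also have "\<dots> \<le> (\<Sum>\<sigma>\<in>int_faces \<Omega> M. 2 * r * (\<Sum>K\<in>face_cells M \<sigma>. ?J K))"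
    by (rule sum_mono) (rule face)
  also have "\<dots> = 2 * r * (\<Sum>\<sigma>\<in>int_faces \<Omega> M. \<Sum>K\<in>face_cells M \<sigma>. ?J K)"
    by (rule sum_distrib_left[symmetric])
  also have "\<dots> \<le> 2 * r * (\<Sum>\<sigma>\<in>mesh_faces M. \<Sum>K\<in>face_cells M \<sigma>. ?J K)"
    by (intro mult_left_mono sum_mono2 finite_mesh_faces sum_nonneg J) (auto simp: int_faces_def r)
  also have "\<dots> = 2 * r * (\<Sum>K\<in>M. \<Sum>\<sigma>\<in>faces K. ?J K)"
    by (simp only: sum_cells_faces[of "\<lambda>K \<sigma>. ?J K"])
  also have "\<dots> \<le> 2 * r * (\<Sum>K\<in>M. 2 * real CARD('d) * ?J K)"
  proof (intro mult_left_mono sum_mono)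
    fix K assume "K \<in> M"
    then have "real (card (faces K)) \<le> real (2 * CARD('d))"
      using card_faces_le cell of_nat_le_iff by blast
    then have "real (card (faces K)) * ?J K \<le> 2 * real CARD('d) * ?J K"
      by (intro mult_right_mono J) simp
    then show "(\<Sum>\<sigma>\<in>faces K. ?J K) \<le> 2 * real CARD('d) * ?J K" by simp
  qed (use r in simp)
  also have "\<dots> = 4 * real CARD('d) * r * (\<Sum>K\<in>M. ?J K)"
    by (simp flip: sum_distrib_left)
  also have "\<dots> \<le> 4 * real CARD('d) * r * (\<integral>x. (norm (u0 x))\<^sup>2 \<partial>lebesgue_on \<Omega>)"
    by (intro mult_left_mono sum_integral_cells_le u0) (use r in auto)
  finally show ?thesis .
qed

section \<open>From the discrete energy to the norm of the velocity function\<close>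

lemma cell_meets_dual_cell:
  assumes "K \<in> M" "x \<in> K" "x \<in> dual_cell M D \<sigma>" shows "\<sigma> \<in> faces K"
proof -
  obtain L where L: "L \<in> M" "\<sigma> \<in> faces L" "x \<in> D L \<sigma>" using assms by (auto simp: dual_cell_def face_cells_def)
  then have "x \<in> closure L" using subvol_subset by blast
  \<comment> \<open>An open set meeting the closure of \<open>L\<close> meets \<open>L\<close>
    itself, and distinct cells are disjoint.\<close>
  then have "K \<inter> L \<noteq> {}"
    using assms mesh_cellD(1)[OF cell[OF assms(1)]] open_Int_closure_eq_empty by blast
  then have "K = L" using cell_unique assms L by blast
  then show ?thesis using L by simp
qed

text \<open>Only the at most 2d faces of \<open>K\<close> contribute at a point of \<open>K\<close>.
  Cauchy-Schwarz bounds the square for any pattern of the indicators, so the point does not have to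
  be located in a particular subvolume.\<close>

lemma velocity_fun_in_cell:
  assumes "K \<in> M" "x \<in> K"
  shows "(norm (velocity_fun M D dt u x t))\<^sup>2 \<le>
    2 * real CARD('d) * (\<Sum>\<sigma>\<in>faces K. (norm (u (time_index dt t) \<sigma>))\<^sup>2)"
proof -
  let ?v = "u (time_index dt t)"
  let ?i = "\<lambda>\<sigma>. indicat_real (interior (dual_cell M D \<sigma>)) x"
  have "velocity_fun M D dt u x t = (\<Sum>\<sigma>\<in>faces K. ?i \<sigma> *\<^sub>R ?v \<sigma>)"
    unfolding velocity_fun_def
  proof (rule sum.mono_neutral_right[OF finite_mesh_faces])
    show "faces K \<subseteq> mesh_faces M" using assms by (auto simp: mesh_faces_def)
    show "\<forall>\<sigma>\<in>mesh_faces M - faces K. ?i \<sigma> *\<^sub>R ?v \<sigma> = 0"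
      using cell_meets_dual_cell[OF assms] interior_subset by (fastforce simp: indicator_def)
  qed
  then have "norm (velocity_fun M D dt u x t) \<le> (\<Sum>\<sigma>\<in>faces K. norm (?v \<sigma>))"
    by (auto intro!: sum_norm_le simp: indicator_def)
  then have "(norm (velocity_fun M D dt u x t))\<^sup>2 \<le> (\<Sum>\<sigma>\<in>faces K. norm (?v \<sigma>))\<^sup>2"
    by (rule power_mono) simp
  also have "\<dots> \<le> real (card (faces K)) * (\<Sum>\<sigma>\<in>faces K. (norm (?v \<sigma>))\<^sup>2)"
    using sum_squared_le_sum_of_squares[of "\<lambda>\<sigma>. norm (?v \<sigma>)" "faces K"] finite_faces[OF assms(1)]
    by (simp add: mult.commute)
  also have "\<dots> \<le> 2 * real CARD('d) * (\<Sum>\<sigma>\<in>faces K. (norm (?v \<sigma>))\<^sup>2)"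
  proof (rule mult_right_mono)
    have "real (card (faces K)) \<le> real (2 * CARD('d))"
      using card_faces_le cell[OF assms(1)] of_nat_le_iff by blast
    then show "real (card (faces K)) \<le> 2 * real CARD('d)" by simp
  qed (simp add: sum_nonneg)
  finally show ?thesis .
qed

text \<open>One factor 2d is the Cauchy-Schwarz constant of \<open>velocity_fun_in_cell\<close>. The
  other converts the volume of a cell into that of its subvolumes, after which the lower density
  bound supplies the weights of \<open>cell_energy\<close>.\<close>

lemma velocity_L2_le:
  assumes a: "0 < a" "\<And>K. K \<in> M \<Longrightarrow> a \<le> \<rho> K"
  shows "a * (LINT x:\<Omega>|lebesgue. (norm (velocity_fun M D dt u x t))\<^sup>2) \<le>
    (2 * real CARD('d))\<^sup>2 * cell_energy \<rho> (u (time_index dt t))"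
proof -
  let ?v = "u (time_index dt t)"
  let ?S = "\<lambda>K. 2 * real CARD('d) * (\<Sum>\<sigma>\<in>faces K. (norm (?v \<sigma>))\<^sup>2)"
  have i: "integrable lebesgue (\<lambda>x. indicat_real K x * ?S K)" if "K \<in> M" for K
    using cell_lmeasurable[OF that] by (simp add: lmeasurable_iff_integrable)
  have "(LINT x:\<Omega>|lebesgue. (norm (velocity_fun M D dt u x t))\<^sup>2) \<le>
      (LINT x|lebesgue. (\<Sum>K\<in>M. indicat_real K x * ?S K))"
    unfolding set_lebesgue_integral_def
  \<comment> \<open>Integrability is asked of the nonnegative majorant only: a left side that is not
    integrable has Bochner integral 0.\<close>
  proof (rule integral_mono_AE')
    show "integrable lebesgue (\<lambda>x. \<Sum>K\<in>M. indicat_real K x * ?S K)"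
      by (rule Bochner_Integration.integrable_sum) (rule i)
    show "AE x in lebesgue. 0 \<le> (\<Sum>K\<in>M. indicat_real K x * ?S K)"
      by (intro AE_I2 sum_nonneg mult_nonneg_nonneg) auto
    have "AE x in lebesgue. x \<in> \<Omega> \<longrightarrow> (\<exists>K\<in>M. x \<in> K)"
      using AE_in_cell domain_lmeasurable by (simp add: AE_restrict_space_iff fmeasurableD)
    then show "AE x in lebesgue. indicat_real \<Omega> x *\<^sub>R (norm (velocity_fun M D dt u x t))\<^sup>2 \<le>
        (\<Sum>K\<in>M. indicat_real K x * ?S K)"
    proof eventually_elim
      fix x assume x: "x \<in> \<Omega> \<longrightarrow> (\<exists>K\<in>M. x \<in> K)"
      show "indicat_real \<Omega> x *\<^sub>R (norm (velocity_fun M D dt u x t))\<^sup>2 \<le> (\<Sum>K\<in>M. indicat_real K x * ?S K)"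
      proof (cases "x \<in> \<Omega>")
        case True
        then obtain K where K: "K \<in> M" "x \<in> K" using x by blast
        show ?thesis unfolding sum_indicator_cells[OF K] using velocity_fun_in_cell[OF K] True by simp
      next
        case False
        then have "indicat_real \<Omega> x *\<^sub>R (norm (velocity_fun M D dt u x t))\<^sup>2 = 0" by simp
        also have "0 \<le> (\<Sum>K\<in>M. indicat_real K x * ?S K)" by (intro sum_nonneg mult_nonneg_nonneg) auto
        finally show ?thesis .
      qed
    qed
  qed
  also have "\<dots> = (\<Sum>K\<in>M. vol K * ?S K)"
  proof -
    have "(LINT x|lebesgue. (\<Sum>K\<in>M. indicat_real K x * ?S K)) = (\<Sum>K\<in>M. (LINT x|lebesgue. indicat_real K x * ?S K))"
      by (rule Bochner_Integration.integral_sum) (rule i)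
    also have "\<dots> = (\<Sum>K\<in>M. vol K * ?S K)"
      by (rule sum.cong[OF refl]) (use cell_lmeasurable in \<open>simp add: vol_def fmeasurableD\<close>)
    finally show ?thesis .
  qed
  finally have "a * (LINT x:\<Omega>|lebesgue. (norm (velocity_fun M D dt u x t))\<^sup>2) \<le> a * (\<Sum>K\<in>M. vol K * ?S K)"
    using a by simp
  also have "\<dots> = (2 * real CARD('d))\<^sup>2 * (\<Sum>K\<in>M. \<Sum>\<sigma>\<in>faces K. vol (D K \<sigma>) * a * (norm (?v \<sigma>))\<^sup>2)"
  proof -
    have "a * (vol K * ?S K) = (2 * real CARD('d))\<^sup>2 * (\<Sum>\<sigma>\<in>faces K. vol (D K \<sigma>) * a * (norm (?v \<sigma>))\<^sup>2)"
      if "K \<in> M" for K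
      unfolding sum_distrib_left
      by (rule sum.cong[OF refl]) (simp add: vol_subvol[OF that] power2_eq_square)
    then show ?thesis by (simp add: sum_distrib_left)
  qed
  also have "\<dots> \<le> (2 * real CARD('d))\<^sup>2 * cell_energy \<rho> ?v"
    unfolding cell_energy_def
    by (intro mult_left_mono sum_mono mult_right_mono) (use a(2) in \<open>auto simp: vol_def\<close>)
  finally show ?thesis .
qed

section \<open>Estimates for the discrete solution\<close>

text \<open>Restates one step from level n to \<open>Suc n\<close>, avoiding the natural-number
  subtraction in \<open>discrete_solution\<close>, so that the inductions below apply it
  directly.\<close>

lemma solution_step:
  assumes sol: "discrete_solution \<Omega> \<rho>0 u0 M D \<zeta> A C N dt \<rho> u p" and n: "n < N"
  shows "\<And>\<sigma>. \<sigma> \<in> ext_faces \<Omega> M \<Longrightarrow> u n \<sigma> = 0" "\<And>\<sigma>. \<sigma> \<in> ext_faces \<Omega> M \<Longrightarrow> u (Suc n) \<sigma> = 0"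
    "scheme_step \<Omega> M D \<zeta> A dt (\<rho> n) (u n) (\<rho> (Suc n)) (u (Suc n)) (p (Suc n))"
    "dual_flux_conditions M A C (primal_flux \<Omega> M (\<rho> (Suc n)) (u (Suc n)))"
    "\<And>K. K \<in> M \<Longrightarrow> (1 / dt) * (\<rho> (Suc n) K - \<rho> n K) +
       (1 / vol K) * (\<Sum>\<sigma>\<in>faces K. primal_flux \<Omega> M (\<rho> (Suc n)) (u (Suc n)) K \<sigma>) = 0"
    "\<And>K. K \<in> M \<Longrightarrow> discrete_div (u (Suc n)) K = 0"
proof -
  have n': "n \<in> {0..N}" "Suc n \<in> {0..N}" "Suc n \<in> {1..N}" using n by auto
  show "\<And>\<sigma>. \<sigma> \<in> ext_faces \<Omega> M \<Longrightarrow> u n \<sigma> = 0" "\<And>\<sigma>. \<sigma> \<in> ext_faces \<Omega> M \<Longrightarrow> u (Suc n) \<sigma> = 0"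
    using sol n'(1,2) unfolding discrete_solution_def by blast+
  have *: "scheme_step \<Omega> M D \<zeta> A dt (\<rho> (Suc n - 1)) (u (Suc n - 1)) (\<rho> (Suc n)) (u (Suc n)) (p (Suc n))"
    "dual_flux_conditions M A C (primal_flux \<Omega> M (\<rho> (Suc n)) (u (Suc n)))"
    using sol n'(3) unfolding discrete_solution_def by blast+
  then show s: "scheme_step \<Omega> M D \<zeta> A dt (\<rho> n) (u n) (\<rho> (Suc n)) (u (Suc n)) (p (Suc n))"
    "dual_flux_conditions M A C (primal_flux \<Omega> M (\<rho> (Suc n)) (u (Suc n)))"
    by simp_all
  show "\<And>K. K \<in> M \<Longrightarrow> (1 / dt) * (\<rho> (Suc n) K - \<rho> n K) +
       (1 / vol K) * (\<Sum>\<sigma>\<in>faces K. primal_flux \<Omega> M (\<rho> (Suc n)) (u (Suc n)) K \<sigma>) = 0"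
    "\<And>K. K \<in> M \<Longrightarrow> discrete_div (u (Suc n)) K = 0"
    using s(1) unfolding scheme_step_def by blast+
qed

lemma solution_density_bounds:
  assumes sol: "discrete_solution \<Omega> \<rho>0 u0 M D \<zeta> A C N dt \<rho> u p" and dt: "0 < dt"
    and init: "\<And>K. K \<in> M \<Longrightarrow> a \<le> \<rho> 0 K \<and> \<rho> 0 K \<le> b"
    and "n \<le> N" "K \<in> M"
  shows "a \<le> \<rho> n K \<and> \<rho> n K \<le> b"
  using \<open>n \<le> N\<close> \<open>K \<in> M\<close>
proof (induction n arbitrary: K)
  case 0
  then show ?case using init by blast
next
  case (Suc n)
  note s = solution_step[OF sol, of n]
  have n: "n < N" using Suc.prems by simp
  have IH: "\<And>L. L \<in> M \<Longrightarrow> a \<le> \<rho> n L \<and> \<rho> n L \<le> b" using Suc.IH n by simp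
  show ?case
    using density_lower_bound[OF s(2)[OF n] dt s(5)[OF n] s(6)[OF n], of a K]
      density_upper_bound[OF s(2)[OF n] dt s(5)[OF n] s(6)[OF n], of b K] IH Suc.prems by blast
qed

text \<open>The term at level n stays on the left so that the induction telescopes; being
  nonnegative, it is dropped only when the uniform bound is read off.\<close>

lemma solution_jump_estimate:
  assumes sol: "discrete_solution \<Omega> \<rho>0 u0 M D \<zeta> A C N dt \<rho> u p" and dt: "0 < dt" and "n \<le> N"
  shows "(\<Sum>K\<in>M. vol K * (\<rho> n K)\<^sup>2) + (\<Sum>k\<in>{1..n}. dt * jump (\<rho> k) (u k)) \<le> (\<Sum>K\<in>M. vol K * (\<rho> 0 K)\<^sup>2)"
  using \<open>n \<le> N\<close>
proof (induction n)
  case (Suc n)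
  note s = solution_step[OF sol, of n]
  have n: "n < N" using Suc.prems by simp
  have "(\<Sum>K\<in>M. vol K * (\<rho> (Suc n) K)\<^sup>2) + dt * jump (\<rho> (Suc n)) (u (Suc n)) \<le> (\<Sum>K\<in>M. vol K * (\<rho> n K)\<^sup>2)"
    by (rule density_L2_estimate) (use s n dt in auto)
  then show ?case using Suc.IH n by simp
qed simp

lemma solution_energy_estimate:
  assumes sol: "discrete_solution \<Omega> \<rho>0 u0 M D \<zeta> A C N dt \<rho> u p" and dt: "0 < dt"
    and shapes: "rt_shape_functions M \<zeta>"
    and pos: "\<And>n K. n \<le> N \<Longrightarrow> K \<in> M \<Longrightarrow> 0 \<le> \<rho> n K" and "n \<le> N"
  shows "cell_energy (\<rho> n) (u n) + 2 * (\<Sum>k\<in>{1..n}. dt * (broken_norm M \<zeta> (u k))\<^sup>2) \<le> cell_energy (\<rho> 0) (u 0)"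
  using \<open>n \<le> N\<close>
proof (induction n)
  case (Suc n)
  note s = solution_step[OF sol, of n]
  have n: "n < N" using Suc.prems by simp
  have "cell_energy (\<rho> (Suc n)) (u (Suc n)) + 2 * dt * (broken_norm M \<zeta> (u (Suc n)))\<^sup>2 \<le> cell_energy (\<rho> n) (u n)"
    by (rule kinetic_energy_estimate[OF s(2)[OF n] s(1)[OF n] dt shapes s(3)[OF n] s(4)[OF n]])
       (use pos n in auto)
  then show ?case using Suc.IH n by simp
qed simp

lemma cell_energy_nonneg:
  assumes "\<And>K. K \<in> M \<Longrightarrow> 0 \<le> \<rho> K" shows "0 \<le> cell_energy \<rho> u"
  unfolding cell_energy_def
  by (intro sum_nonneg mult_nonneg_nonneg) (auto simp: assms vol_def)

lemma weak_BV_eq: "weak_BV \<Omega> M N dt \<rho> u = (\<Sum>n\<in>{1..N}. dt * jump (\<rho> n) (u n))"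
  by (simp add: weak_BV_def jump_def cell_pair_def)

lemma density_fun_in_cell: "K \<in> M \<Longrightarrow> x \<in> K \<Longrightarrow> density_fun M dt \<rho> x t = \<rho> (time_index dt t) K"
  unfolding density_fun_def by (rule sum_indicator_cells)

end

theorem proposition8p1:
  fixes \<Omega> :: "(real^'d) set"
    and \<rho>0 :: "real^'d \<Rightarrow> real" and u0 :: "real^'d \<Rightarrow> real^'d"
    and T \<theta>0 \<rho>min \<rho>max :: real
  assumes "CARD('d) \<in> {2, 3}"
    and "polyhedral_domain \<Omega>"
    and "0 < T"
    and "\<rho>0 \<in> borel_measurable (lebesgue_on \<Omega>)"
    and "\<exists>B. AE x in lebesgue_on \<Omega>. \<bar>\<rho>0 x\<bar> \<le> B"
    and "essinf (lebesgue_on \<Omega>) (\<lambda>x. ereal (\<rho>0 x)) = ereal \<rho>min"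
    and "esssup (lebesgue_on \<Omega>) (\<lambda>x. ereal (\<rho>0 x)) = ereal \<rho>max"
    and "0 < \<rho>min"
    and "u0 \<in> borel_measurable (lebesgue_on \<Omega>)"
    and "integrable (lebesgue_on \<Omega>) (\<lambda>x. (norm (u0 x))\<^sup>2)"
    and "0 < \<theta>0"
  shows "\<exists>C0>0. \<exists>C1>0. \<forall>M D \<zeta> A C N dt \<rho> u p.
    staggered \<Omega> M D \<and> mesh_theta M D \<le> ennreal \<theta>0 \<and>
    rt_shape_functions M \<zeta> \<and>
    1 \<le> N \<and> dt = T / real N \<and>
    discrete_solution \<Omega> \<rho>0 u0 M D \<zeta> A C N dt \<rho> u p \<longrightarrow>
      (\<forall>t\<in>{0<..T}. AE x in lebesgue_on \<Omega>.
         \<rho>min \<le> density_fun M dt \<rho> x t \<and> density_fun M dt \<rho> x t \<le> \<rho>max) \<and>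
      weak_BV \<Omega> M N dt \<rho> u \<le> C0 \<and>
      Linf_L2_norm \<Omega> T (velocity_fun M D dt u) + ereal (L2_broken_norm M \<zeta> N dt u) \<le> ereal C1"
proof -
  \<comment> \<open>The right side of \<open>cell_energy_initial\<close> with r = |\<rho>max|; the
    absolute value makes it nonnegative before any cell is at hand.\<close>
  let ?E = "4 * real CARD('d) * \<bar>\<rho>max\<bar> * (\<integral>x. (norm (u0 x))\<^sup>2 \<partial>lebesgue_on \<Omega>)"
  define E where "E = ?E"
  \<comment> \<open>Obtained from \<open>velocity_L2_le\<close> with a = \<rho>min, after inserting
    the energy bound \<open>E\<close> and dividing by \<rho>min.\<close>
  define S where "S = sqrt ((2 * real CARD('d))\<^sup>2 * E / \<rho>min)"
  have E: "0 \<le> E" by (simp add: E_def)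
  have S: "0 \<le> S" by (simp add: S_def E \<open>0 < \<rho>min\<close> less_imp_le)
  have lo: "AE x in lebesgue_on \<Omega>. \<rho>min \<le> \<rho>0 x"
  proof -
    have "esssup (lebesgue_on \<Omega>) (\<lambda>x. - ereal (\<rho>0 x)) = - ereal \<rho>min"
      using assms(6) unfolding essinf_def by (metis ereal_uminus_uminus)
    then have "AE x in lebesgue_on \<Omega>. - ereal (\<rho>0 x) \<le> - ereal \<rho>min"
      using esssup_AE[of "\<lambda>x. - ereal (\<rho>0 x)" "lebesgue_on \<Omega>"] by simp
    then show ?thesis by (rule eventually_mono) simp
  qed
  have up: "AE x in lebesgue_on \<Omega>. \<rho>0 x \<le> \<rho>max"
    using esssup_AE[of "\<lambda>x. ereal (\<rho>0 x)" "lebesgue_on \<Omega>"] assms(7) by simp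
  show ?thesis
  proof (intro exI conjI allI impI)
    \<comment> \<open>Both constants are fixed before the mesh and the time step. The added 1
      ensures strict positivity, for instance of the velocity constant when u0 = 0.\<close>
    show "0 < vol \<Omega> * \<rho>max\<^sup>2 + 1" by (simp add: vol_def add_nonneg_pos)
    show "0 < S + sqrt (E / 2) + 1" using S E by (simp add: add_nonneg_pos)
    fix M :: "(real^'d) set set" and D :: "'d subvols" and \<zeta> :: "'d shapes" and A :: "'d flux_coeffs"
      and C :: real and N :: nat and dt :: real and \<rho> :: "nat \<Rightarrow> 'd scalars" and u :: "nat \<Rightarrow> 'd vectors"
      and p :: "nat \<Rightarrow> 'd scalars"
    assume H: "staggered \<Omega> M D \<and> mesh_theta M D \<le> ennreal \<theta>0 \<and> rt_shape_functions M \<zeta> \<and>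
      1 \<le> N \<and> dt = T / real N \<and> discrete_solution \<Omega> \<rho>0 u0 M D \<zeta> A C N dt \<rho> u p"
    then interpret staggered_mesh \<Omega> M D using assms(2) by unfold_locales auto
    have N: "1 \<le> N" "dt = T / real N" and shapes: "rt_shape_functions M \<zeta>"
      and sol: "discrete_solution \<Omega> \<rho>0 u0 M D \<zeta> A C N dt \<rho> u p" using H by auto
    have dt: "0 < dt" using N assms(3) by simp
    have \<rho>0: "\<rho>min \<le> \<rho> 0 K \<and> \<rho> 0 K \<le> \<rho>max" if "K \<in> M" for K
      using cell_average_bounds[OF assms(4) lo up that] sol that by (simp add: discrete_solution_def)
    have bounds: "\<rho>min \<le> \<rho> n K \<and> \<rho> n K \<le> \<rho>max" if "n \<le> N" "K \<in> M" for n K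
      by (rule solution_density_bounds[OF sol dt]) (use \<rho>0 that in auto)
    have pos: "0 \<le> \<rho> n K" if "n \<le> N" "K \<in> M" for n K
      using bounds[OF that] assms(8) by simp
    have index: "time_index dt t \<in> {1..N}" if "0 < t" "t \<le> T" for t
      using time_index_range that N by blast
    have energy0: "cell_energy (\<rho> 0) (u 0) \<le> E"
      unfolding E_def
    proof (rule cell_energy_initial[OF assms(10)])
      show "\<rho> 0 K \<le> \<bar>\<rho>max\<bar>" if "K \<in> M" for K
        using \<rho>0[OF that] abs_ge_self[of \<rho>max] by linarith
    qed (use sol in \<open>auto simp: discrete_solution_def\<close>)
    have energy: "cell_energy (\<rho> n) (u n) + 2 * (\<Sum>k\<in>{1..n}. dt * (broken_norm M \<zeta> (u k))\<^sup>2) \<le> E" if "n \<le> N" for n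
      using solution_energy_estimate[OF sol dt shapes pos that] energy0 by simp
    show "\<forall>t\<in>{0<..T}. AE x in lebesgue_on \<Omega>.
         \<rho>min \<le> density_fun M dt \<rho> x t \<and> density_fun M dt \<rho> x t \<le> \<rho>max"
    proof
      fix t assume "t \<in> {0<..T}"
      then have n: "time_index dt t \<le> N" using index by fastforce
      from AE_in_cell show "AE x in lebesgue_on \<Omega>.
         \<rho>min \<le> density_fun M dt \<rho> x t \<and> density_fun M dt \<rho> x t \<le> \<rho>max"
      proof eventually_elim
        fix x assume "\<exists>K\<in>M. x \<in> K"
        then obtain K where K: "K \<in> M" "x \<in> K" by blast
        show "\<rho>min \<le> density_fun M dt \<rho> x t \<and> density_fun M dt \<rho> x t \<le> \<rho>max"
          unfolding density_fun_in_cell[OF K] by (rule bounds[OF n K(1)])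
      qed
    qed
    show "weak_BV \<Omega> M N dt \<rho> u \<le> vol \<Omega> * \<rho>max\<^sup>2 + 1"
    proof -
      have "0 \<le> (\<Sum>K\<in>M. vol K * (\<rho> N K)\<^sup>2)" by (simp add: sum_nonneg vol_def)
      then have "weak_BV \<Omega> M N dt \<rho> u \<le> (\<Sum>K\<in>M. vol K * (\<rho> 0 K)\<^sup>2)"
        unfolding weak_BV_eq using solution_jump_estimate[OF sol dt order_refl] by linarith
      also have "\<dots> \<le> (\<Sum>K\<in>M. vol K * \<rho>max\<^sup>2)"
        by (intro sum_mono mult_left_mono power_mono) (use \<rho>0 pos[of 0] in \<open>auto simp: vol_def\<close>)
      also have "\<dots> = (\<Sum>K\<in>M. vol K) * \<rho>max\<^sup>2" by (simp add: sum_distrib_right)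
      also have "\<dots> \<le> vol \<Omega> * \<rho>max\<^sup>2" by (intro mult_right_mono sum_vol_cells_le) simp
      finally show ?thesis by simp
    qed
    have "Linf_L2_norm \<Omega> T (velocity_fun M D dt u) \<le> ereal S"
      unfolding Linf_L2_norm_def
    proof (rule esssup_I)
      \<comment> \<open>Time enters the spatial norm only through \<open>time_index\<close>.\<close>
      have "(\<lambda>t. ereal (L2_norm_on \<Omega> (\<lambda>x. velocity_fun M D dt u x t))) \<in> borel_measurable borel"
        unfolding velocity_fun_def by (rule measurable_time_index)
      then show "(\<lambda>t. ereal (L2_norm_on \<Omega> (\<lambda>x. velocity_fun M D dt u x t))) \<in> borel_measurable (lebesgue_on {0<..<T})"
        by (intro measurable_restrict_space1 measurable_completion) simp
      show "AE t in lebesgue_on {0<..<T}. ereal (L2_norm_on \<Omega> (\<lambda>x. velocity_fun M D dt u x t)) \<le> ereal S"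
      proof (rule AE_I2)
        fix t assume "t \<in> space (lebesgue_on {0<..<T})"
        then have t: "0 < t" "t \<le> T" by auto
        let ?n = "time_index dt t"
        have n: "?n \<le> N" using index[OF t] by simp
        have "\<rho>min * (LINT x:\<Omega>|lebesgue. (norm (velocity_fun M D dt u x t))\<^sup>2) \<le>
            (2 * real CARD('d))\<^sup>2 * cell_energy (\<rho> ?n) (u ?n)"
          by (rule velocity_L2_le[OF assms(8)]) (use bounds[OF n] in blast)
        also have "\<dots> \<le> (2 * real CARD('d))\<^sup>2 * E"
        proof (rule mult_left_mono)
          have "0 \<le> (\<Sum>k\<in>{1..?n}. dt * (broken_norm M \<zeta> (u k))\<^sup>2)" using dt by (simp add: sum_nonneg)
          then show "cell_energy (\<rho> ?n) (u ?n) \<le> E" using energy[OF n] by linarith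
        qed simp
        finally have "(LINT x:\<Omega>|lebesgue. (norm (velocity_fun M D dt u x t))\<^sup>2) \<le> (2 * real CARD('d))\<^sup>2 * E / \<rho>min"
          using assms(8) by (simp add: pos_le_divide_eq mult.commute)
        then show "ereal (L2_norm_on \<Omega> (\<lambda>x. velocity_fun M D dt u x t)) \<le> ereal S"
          by (simp add: L2_norm_on_def S_def)
      qed
    qed
    \<comment> \<open>The half reflects the factor 2 in front of the diffusion sum in the energy
      estimate.\<close>
    moreover have "L2_broken_norm M \<zeta> N dt u \<le> sqrt (E / 2)"
      unfolding L2_broken_norm_def
    proof (rule real_sqrt_le_mono)
      have "0 \<le> cell_energy (\<rho> N) (u N)" by (rule cell_energy_nonneg) (rule pos[OF order_refl])
      then show "(\<Sum>n\<in>{1..N}. dt * (broken_norm M \<zeta> (u n))\<^sup>2) \<le> E / 2"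
        using energy[OF order_refl] by linarith
    qed
    ultimately have "Linf_L2_norm \<Omega> T (velocity_fun M D dt u) + ereal (L2_broken_norm M \<zeta> N dt u) \<le>
        ereal S + ereal (sqrt (E / 2))"
      by (intro add_mono) simp_all
    also have "\<dots> \<le> ereal (S + sqrt (E / 2) + 1)" by simp
    finally show "Linf_L2_norm \<Omega> T (velocity_fun M D dt u) + ereal (L2_broken_norm M \<zeta> N dt u) \<le>
        ereal (S + sqrt (E / 2) + 1)" .
  qed
qed

end
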